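(* Let $a_0>0$ and consider the differential equation on $\mathrm{GL}(n,\mathbb{R})$ $$\dot E = -a_0 E\log(E).$$ On the set $E\in B(I_n,1)$, this vector field is differentially equivalent to the vector field $$\dot e = -a_0 e,$$ where $e := \log(E)$. Moreover, the equilibrium point $E=I_n$ of $\dot E=-a_0E\log(E)$ is locally exponentially stable.
   Context: $\|\cdot\|$ is the matrix norm induced by the Euclidean norm, $I_n$ is the identity matrix and $B(A,r)=\{X\in\mathbb{R}^{n\times n}:\|A-X\|<r\}$; one has $B(I_n,1)\subset\mathrm{GL}(n,\mathbb{R})$. For a real matrix $X$ with no eigenvalue in $(-\infty,0]$, $\log(X)$ is the principal logarithm: the unique real $A$ with $\exp(A)=X$ whose eigenvalues all lie in $\{z\in\mathbb{C}:-\pi<\mathrm{Im}(z)<\pi\}$; for $X\in B(I_n,1)$ it equals $\sum_{k\ge1}\frac{(-1)^{k+1}}{k}(X-I_n)^k$. The map $\log:B(I_n,1)\to\mathbb{R}^{n\times n}$ is a diffeomorphism onto its image. "Differentially equivalent" means that this diffeomorphism (change of coordinates $e=\log(E)$) transforms the first vector field into the second. *)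

theory Defs
  imports "HOL-Analysis.Analysis"
begin

section \<open>Matrix norm, exponential and principal logarithm\<close>

text \<open>The library norm on \<^typ>\<open>real^'n^'n\<close> is the Frobenius norm, and its \<^term>\<open>(*)\<close> is the
  entrywise product. Hence the induced norm, matrix powers and the matrix exponential are
  defined explicitly below.\<close>

definition mat_norm :: "real^'n^'n \<Rightarrow> real" where
  "mat_norm A = onorm (\<lambda>v. A *v v)"

definition mat_ball :: "real^'n^'n \<Rightarrow> real \<Rightarrow> (real^'n^'n) set" where
  "mat_ball A r = {X. mat_norm (A - X) < r}"

definition GL :: "(real^'n^'n) set" where
  "GL = {X. invertible X}"

primrec mat_power :: "real^'n^'n \<Rightarrow> nat \<Rightarrow> real^'n^'n" where
  "mat_power A 0 = mat 1"
| "mat_power A (Suc k) = A ** mat_power A k"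

definition mat_exp :: "real^'n^'n \<Rightarrow> real^'n^'n" where
  "mat_exp A = (\<Sum>k. (1 / fact k) *\<^sub>R mat_power A k)"

definition complex_eigenvalue :: "real^'n^'n \<Rightarrow> complex \<Rightarrow> bool" where
  "complex_eigenvalue A z \<longleftrightarrow> (\<exists>v. v \<noteq> 0 \<and> map_matrix complex_of_real A *v v = z *s v)"

definition mat_log_domain :: "(real^'n^'n) set" where
  "mat_log_domain = {X. \<forall>z. complex_eigenvalue X z \<longrightarrow> z \<notin> \<real>\<^sub>\<le>\<^sub>0}"

text \<open>Meaningful only for arguments in \<^term>\<open>mat_log_domain\<close>, where the description is unique.\<close>

definition mat_log :: "real^'n^'n \<Rightarrow> real^'n^'n" where
  "mat_log X = (THE A. mat_exp A = X \<and>
      (\<forall>z. complex_eigenvalue A z \<longrightarrow> - pi < Im z \<and> Im z < pi))"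

section \<open>Diffeomorphisms and differential equivalence of vector fields\<close>

text \<open>\<open>Ck_on k S f\<close>: on the open set \<open>S\<close> the function \<open>f\<close> is \<open>k\<close> times continuously
  differentiable, via iterated directional derivatives. In finite dimension, this agrees with
  continuity of the iterated Frechet derivatives.\<close>

primrec Ck_on :: "nat \<Rightarrow> 'a::euclidean_space set \<Rightarrow> ('a \<Rightarrow> 'b::euclidean_space) \<Rightarrow> bool" where
  "Ck_on 0 S f \<longleftrightarrow> continuous_on S f"
| "Ck_on (Suc k) S f \<longleftrightarrow> (\<forall>x\<in>S. f differentiable (at x)) \<and>
     (\<forall>v. Ck_on k S (\<lambda>x. frechet_derivative f (at x) v))"

definition smooth_on :: "'a::euclidean_space set \<Rightarrow> ('a \<Rightarrow> 'b::euclidean_space) \<Rightarrow> bool" where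
  "smooth_on S f \<longleftrightarrow> (\<forall>k. Ck_on k S f)"

definition diffeomorphism_onto_image ::
    "'a::euclidean_space set \<Rightarrow> ('a \<Rightarrow> 'b::euclidean_space) \<Rightarrow> bool" where
  "diffeomorphism_onto_image U f \<longleftrightarrow>
     open U \<and> open (f ` U) \<and> inj_on f U \<and>
     smooth_on U f \<and> smooth_on (f ` U) (inv_into U f)"

text \<open>The change of coordinates \<open>\<phi>\<close> transforms the vector field \<open>F\<close> on \<open>U\<close> into the vector
  field \<open>G\<close> on \<open>\<phi> ` U\<close>: the differential of \<open>\<phi>\<close> at \<open>x\<close> maps \<open>F x\<close> to \<open>G (\<phi> x)\<close>.\<close>

definition diff_equivalent_via ::
    "('a::euclidean_space \<Rightarrow> 'b::euclidean_space) \<Rightarrow> 'a set \<Rightarrow> ('a \<Rightarrow> 'a) \<Rightarrow> ('b \<Rightarrow> 'b) \<Rightarrow> bool" where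
  "diff_equivalent_via \<phi> U F G \<longleftrightarrow>
     diffeomorphism_onto_image U \<phi> \<and>
     (\<forall>x\<in>U. frechet_derivative \<phi> (at x) (F x) = G (\<phi> x))"

section \<open>Local exponential stability\<close>

definition ode_solution ::
    "(real^'n^'n \<Rightarrow> real^'n^'n) \<Rightarrow> (real^'n^'n) set \<Rightarrow> real set \<Rightarrow> (real \<Rightarrow> real^'n^'n) \<Rightarrow> bool" where
  "ode_solution F D J x \<longleftrightarrow>
     (\<forall>t\<in>J. x t \<in> D \<and> (x has_vector_derivative F (x t)) (at t within J))"

text \<open>Besides the exponential estimate for every solution, on every interval on which it exists,
  solutions starting near the equilibrium are required to exist for all \<open>t \<ge> 0\<close>.\<close>

definition locally_exponentially_stable ::
    "(real^'n^'n \<Rightarrow> real^'n^'n) \<Rightarrow> (real^'n^'n) set \<Rightarrow> real^'n^'n \<Rightarrow> bool" where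
  "locally_exponentially_stable F D p \<longleftrightarrow>
     p \<in> D \<and> F p = 0 \<and>
     (\<exists>\<delta>>0. \<exists>K>0. \<exists>\<alpha>>0. \<forall>x0\<in>D. mat_norm (x0 - p) < \<delta> \<longrightarrow>
        (\<exists>x. x 0 = x0 \<and> ode_solution F D {0..} x) \<and>
        (\<forall>T>0. \<forall>x. x 0 = x0 \<and> ode_solution F D {0..<T} x \<longrightarrow>
           (\<forall>t\<in>{0..<T}. mat_norm (x t - p) \<le> K * exp (- \<alpha> * t) * mat_norm (x0 - p))))"

end

theory Submission
  imports Defs "HOL-Computational_Algebra.Fundamental_Theorem_Algebra"
begin

text \<open>In the coordinate \<open>e = log E\<close> the vector field \<open>- a E log E\<close> becomes \<open>- a e\<close> because \<open>E\<close> and \<open>log E\<close>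
commute: along directions \<open>V\<close> that commute with \<open>E\<close> the derivative of the logarithm is
\<open>V \<mapsto> E\<^sup>-\<^sup>1 V\<close>, as for scalars, and \<open>V = - a E log E\<close> is such a direction
(\<open>mat_log_derivative_radial\<close>). The linear equation \<open>e' = - a e\<close> contracts exponentially, and
\<open>log\<close> and \<open>exp\<close> distort distances to the equilibrium only by bounded factors near it. Explicitly the
solutions are \<open>exp (exp (- a t) log E\<^sub>0)\<close>; a solution that starts close enough to the identity cannot
escape the ball on which this formula is valid (\<open>log_flow_estimate\<close>).

This needs the principal logarithm, defined by its spectrum, to be given on the unit ball by the
power series of \<open>ln (1 + z)\<close> (\<open>mat_log_eq_log1p\<close>). The series is a logarithm
(\<open>mat_exp_log1p\<close>) and its eigenvalues are values of the principal branch
(\<open>principal_strip_log1p\<close>). Every other logarithm of the same matrix commutes with it, and two commuting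
logarithms with spectrum in the strip \<open>\<bar>Im z\<bar> < \<pi>\<close> agree (\<open>commuting_principal_logs_eq\<close>).

Finally, the logarithm is a diffeomorphism because the series for \<open>log\<close> and \<open>exp\<close> are smooth and
inverse to each other (\<open>mat_log_diffeomorphism\<close>). Smoothness comes from a class of series of
noncommutative polynomials, dominated by scalar majorants, that contains matrix power series and is
closed under directional derivatives (\<open>majorised_Ck_on\<close>).\<close>

section \<open>The induced matrix norm\<close>

lemma bounded_bilinear_matrix_mult:
  "bounded_bilinear ((**) :: real^'n^'m \<Rightarrow> real^'p^'n \<Rightarrow> real^'p^'m)"
proof -
  have "bilinear ((**) :: real^'n^'m \<Rightarrow> real^'p^'n \<Rightarrow> real^'p^'m)"
    unfolding bilinear_def
    by (auto intro!: linearI simp: vec_eq_iff matrix_matrix_mult_def sum.distrib algebra_simps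
        sum_distrib_left)
  then show ?thesis
    by (simp add: bilinear_conv_bounded_bilinear)
qed

interpretation matmul: bounded_bilinear "(**) :: real^'n^'n \<Rightarrow> real^'n^'n \<Rightarrow> real^'n^'n"
  by (rule bounded_bilinear_matrix_mult)

lemma mat_norm_nonneg: "0 \<le> mat_norm (A :: real^'n^'n)"
  unfolding mat_norm_def by (rule onorm_pos_le) simp

lemma norm_matrix_vector_le: "norm (A *v x) \<le> mat_norm A * norm x" for A :: "real^'n^'n"
  unfolding mat_norm_def by (rule onorm) simp

lemma mat_norm_0 [simp]: "mat_norm (0 :: real^'n^'n) = 0"
  by (simp add: mat_norm_def onorm_zero)

lemma mat_norm_triangle: "mat_norm (A + B) \<le> mat_norm A + mat_norm B" for A B :: "real^'n^'n"
  unfolding mat_norm_def matrix_vector_mult_add_rdistrib by (rule onorm_triangle) simp_all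

lemma mat_norm_scaleR: "mat_norm (c *\<^sub>R A) = \<bar>c\<bar> * mat_norm A" for A :: "real^'n^'n"
  unfolding mat_norm_def scaleR_matrix_vector_assoc[symmetric] by (rule onorm_scaleR) simp

lemma mat_norm_minus: "mat_norm (- A) = mat_norm A" for A :: "real^'n^'n"
  using mat_norm_scaleR[of "-1" A] by simp

lemma mat_norm_diff_commute: "mat_norm (A - B) = mat_norm (B - A)" for A B :: "real^'n^'n"
  using mat_norm_minus[of "A - B"] by simp

lemma mat_norm_mult: "mat_norm (A ** B) \<le> mat_norm A * mat_norm B" for A B :: "real^'n^'n"
  using onorm_compose[of "(*v) A" "(*v) B"]
  by (simp add: mat_norm_def o_def matrix_vector_mul_assoc)

lemma mat_norm_mat_1 [simp]: "mat_norm (mat 1 :: real^'n^'n) = 1"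
  by (simp add: mat_norm_def onorm_id)

lemma mat_norm_le_norm:
  "mat_norm A \<le> (real CARD('n))\<^sup>2 * norm A" for A :: "real^'n^'n"
proof -
  have "\<bar>A$i$j\<bar> \<le> norm A" for i j
    using component_le_norm_cart[of "A$i" j] Finite_Cartesian_Product.norm_nth_le[of A i] by linarith
  from onorm_le_matrix_component[OF this] show ?thesis
    by (simp add: mat_norm_def power2_eq_square)
qed

lemma norm_le_mat_norm:
  "norm A \<le> (real CARD('n))\<^sup>2 * mat_norm A" for A :: "real^'n^'n"
proof -
  have c: "\<bar>A$i$j\<bar> \<le> mat_norm A" for i j
  proof -
    have "\<bar>A$i$j\<bar> = \<bar>(A *v axis j 1) $ i\<bar>"
      by (simp add: matrix_vector_mult_basis column_def)
    also have "\<dots> \<le> norm (A *v axis j 1)" by (rule component_le_norm_cart)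
    also have "\<dots> \<le> mat_norm A * norm (axis j 1 :: real^'n)" by (rule norm_matrix_vector_le)
    finally show ?thesis by simp
  qed
  have "norm (A$i) \<le> real CARD('n) * mat_norm A" for i
    using norm_le_l1_cart[of "A$i"] sum_bounded_above[of UNIV "\<lambda>j. \<bar>A$i$j\<bar>" "mat_norm A"] c
    by (smt (verit))
  moreover have "norm A \<le> (\<Sum>i\<in>UNIV. norm (A$i))"
    by (simp add: norm_vec_def L2_set_le_sum)
  ultimately show ?thesis
    using sum_bounded_above[of UNIV "\<lambda>i. norm (A$i)" "real CARD('n) * mat_norm A"]
    by (smt (verit, best) mult.assoc power2_eq_square)
qed

lemma continuous_on_mat_norm: "continuous_on S (mat_norm :: real^'n^'n \<Rightarrow> real)"
proof (rule continuous_on_subset[of UNIV])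
  have "\<bar>mat_norm A - mat_norm B\<bar> \<le> (real CARD('n))\<^sup>2 * dist A B" for A B :: "real^'n^'n"
    using mat_norm_triangle[of "A - B" B] mat_norm_triangle[of "B - A" A]
      mat_norm_le_norm[of "A - B"] mat_norm_diff_commute[of A B]
    by (simp add: dist_norm)
  then have "((real CARD('n))\<^sup>2)-lipschitz_on UNIV (mat_norm :: real^'n^'n \<Rightarrow> real)"
    by (intro lipschitz_onI) (auto simp: dist_real_def)
  then show "continuous_on UNIV (mat_norm :: real^'n^'n \<Rightarrow> real)"
    by (rule lipschitz_on_continuous_on)
qed simp

lemma in_mat_ball: "X \<in> mat_ball A r \<longleftrightarrow> mat_norm (X - A) < r" for A :: "real^'n^'n"
  by (simp add: mat_ball_def mat_norm_diff_commute)

lemma open_mat_ball: "open (mat_ball A r)" for A :: "real^'n^'n"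
  unfolding mat_ball_def
  by (intro open_Collect_less continuous_intros continuous_on_compose2[OF continuous_on_mat_norm[of UNIV]])
    auto

lemma convex_mat_ball: "convex (mat_ball A r)" for A :: "real^'n^'n"
proof (rule convexI)
  fix X Y :: "real^'n^'n" and u v :: real
  assume X: "X \<in> mat_ball A r" and Y: "Y \<in> mat_ball A r" and uv: "0 \<le> u" "0 \<le> v" "u + v = 1"
  have "u *\<^sub>R X + v *\<^sub>R Y - A = u *\<^sub>R (X - A) + v *\<^sub>R (Y - A)"
    using uv(3) by (simp add: algebra_simps flip: scaleR_left_distrib)
  then have "mat_norm (u *\<^sub>R X + v *\<^sub>R Y - A) \<le> u * mat_norm (X - A) + v * mat_norm (Y - A)"
    using mat_norm_triangle[of "u *\<^sub>R (X - A)" "v *\<^sub>R (Y - A)"] uv by (simp add: mat_norm_scaleR)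
  also have "\<dots> < r"
    using X Y uv by (intro convex_bound_lt) (auto simp: in_mat_ball)
  finally show "u *\<^sub>R X + v *\<^sub>R Y \<in> mat_ball A r" by (simp add: in_mat_ball)
qed

lemma mat_power_commute:
  "A ** X = X ** A \<Longrightarrow> A ** mat_power X k = mat_power X k ** A"
  by (induction k) (simp_all, metis matrix_mul_assoc)

lemma mat_power_Suc2: "mat_power A (Suc k) = mat_power A k ** A"
  by (simp add: mat_power_commute)

lemma mat_norm_power_le: "mat_norm (mat_power A k) \<le> mat_norm A ^ k" for A :: "real^'n^'n"
proof (induction k)
  case (Suc k)
  have "mat_norm (mat_power A (Suc k)) \<le> mat_norm A * mat_norm (mat_power A k)"
    by (simp add: mat_norm_mult)
  also have "\<dots> \<le> mat_norm A * mat_norm A ^ k"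
    by (intro mult_left_mono Suc mat_norm_nonneg)
  finally show ?case by simp
qed simp

lemma summable_if_mat_norm_summable:
  assumes "summable b" "\<And>k. mat_norm (f k) \<le> b k"
  shows "summable (f :: nat \<Rightarrow> real^'n^'n)"
proof (rule summable_comparison_test')
  show "summable (\<lambda>k. (real CARD('n))\<^sup>2 * b k)" by (intro summable_mult assms)
  show "norm (f k) \<le> (real CARD('n))\<^sup>2 * b k" if "k \<ge> 0" for k
    using norm_le_mat_norm[of "f k"] assms(2)[of k] by (smt (verit) mult_left_mono zero_le_power2)
qed

lemma mat_norm_sum_le: "mat_norm (\<Sum>i\<in>I. f i) \<le> (\<Sum>i\<in>I. mat_norm (f i))"
  for f :: "'a \<Rightarrow> real^'n^'n"
proof (induction I rule: infinite_finite_induct)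
  case (insert x F)
  then show ?case using mat_norm_triangle[of "f x" "sum f F"] by simp
qed simp_all

lemma mat_norm_sums_le:
  fixes f :: "nat \<Rightarrow> real^'n^'n"
  assumes "f sums F" "b sums B" "\<And>k. mat_norm (f k) \<le> b k"
  shows "mat_norm F \<le> B"
proof (rule LIMSEQ_le)
  show "(\<lambda>n. mat_norm (\<Sum>i<n. f i)) \<longlonglongrightarrow> mat_norm F"
    using continuous_on_tendsto_compose[OF continuous_on_mat_norm[of UNIV]] assms(1)
    by (auto simp: sums_def)
  show "(\<lambda>n. \<Sum>i<n. b i) \<longlonglongrightarrow> B" using assms(2) by (simp add: sums_def)
  show "\<exists>N. \<forall>n\<ge>N. mat_norm (\<Sum>i<n. f i) \<le> (\<Sum>i<n. b i)"
    by (intro exI[of _ 0] allI impI order_trans[OF mat_norm_sum_le sum_mono] assms(3))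
qed

section \<open>Series of noncommutative polynomials\<close>

text \<open>The directional derivative of a matrix power series is no longer a power series: differentiating
\<open>X\<^sup>k\<close> in direction \<open>V\<close> gives the words \<open>X\<^sup>i V X\<^sup>j\<close>. The class below, noncommutative polynomials in
\<open>X - C\<close> with matrix constants, is closed under directional derivatives. Each one carries a real
polynomial majorant with nonnegative coefficients, got by replacing \<open>X - C\<close> with a variable and each
constant with its norm; differentiating in direction \<open>V\<close> replaces the majorant \<open>p\<close> by
\<open>\<parallel>V\<parallel> p'\<close>. So convergence questions are about real polynomials only.\<close>
inductive mat_polynomial ::
    "real^'n^'n \<Rightarrow> (real^'n^'n \<Rightarrow> real^'n^'n) \<Rightarrow> real poly \<Rightarrow> bool" for C where
  const: "mat_polynomial C (\<lambda>_. A) [:mat_norm A:]"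
| shift: "mat_polynomial C (\<lambda>X. X - C) [:0, 1:]"
| add: "mat_polynomial C f p \<Longrightarrow> mat_polynomial C g q \<Longrightarrow> mat_polynomial C (\<lambda>X. f X + g X) (p + q)"
| mult: "mat_polynomial C f p \<Longrightarrow> mat_polynomial C g q \<Longrightarrow> mat_polynomial C (\<lambda>X. f X ** g X) (p * q)"

lemma mat_polynomial_coeff_nonneg: "mat_polynomial C f p \<Longrightarrow> 0 \<le> coeff p i"
proof (induction arbitrary: i rule: mat_polynomial.induct)
  case (const A)
  then show ?case by (simp add: coeff_pCons mat_norm_nonneg split: nat.split)
qed (auto simp: coeff_pCons coeff_mult sum_nonneg split: nat.split)

lemma poly_nonneg_of_coeff_nonneg:
  "(\<And>i. 0 \<le> coeff p i) \<Longrightarrow> 0 \<le> x \<Longrightarrow> 0 \<le> poly p x" for x :: real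
  by (simp add: poly_altdef sum_nonneg)

lemma poly_mono_of_coeff_nonneg:
  "(\<And>i. 0 \<le> coeff p i) \<Longrightarrow> 0 \<le> x \<Longrightarrow> x \<le> y \<Longrightarrow> poly p x \<le> poly p y" for x :: real
  by (auto simp: poly_altdef intro!: sum_mono mult_left_mono power_mono)

lemma mat_norm_mat_polynomial_le:
  "mat_polynomial C f p \<Longrightarrow> mat_norm (f X) \<le> poly p (mat_norm (X - C))"
proof (induction rule: mat_polynomial.induct)
  case (add f p g q)
  then show ?case using mat_norm_triangle[of "f X" "g X"] by simp
next
  case (mult f p g q)
  have "mat_norm (f X ** g X) \<le> mat_norm (f X) * mat_norm (g X)" by (rule mat_norm_mult)
  also have "\<dots> \<le> poly p (mat_norm (X - C)) * poly q (mat_norm (X - C))"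
    using mult by (intro mult_mono mult.IH)
      (auto intro!: mat_norm_nonneg poly_nonneg_of_coeff_nonneg mat_polynomial_coeff_nonneg)
  finally show ?case by simp
qed simp_all

lemma mat_polynomial_has_derivative:
  assumes "mat_polynomial C f p"
  shows "\<exists>f'. (\<forall>X. (f has_derivative f' X) (at X)) \<and>
    (\<forall>v. mat_polynomial C (\<lambda>X. f' X v) (smult (mat_norm v) (pderiv p)))"
  using assms
proof (induction rule: mat_polynomial.induct)
  case (const A)
  show ?case
    using mat_polynomial.const[of C 0] by (intro exI[of _ "\<lambda>_ _. 0"]) (simp add: pderiv_pCons)
next
  case shift
  show ?case
    using mat_polynomial.const[of C]
    by (intro exI[of _ "\<lambda>_ v. v"]) (auto intro!: derivative_eq_intros simp: pderiv_pCons)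
next
  case (add f p g q)
  then obtain f' g' where
    "\<And>X. (f has_derivative f' X) (at X)" "\<And>v. mat_polynomial C (\<lambda>X. f' X v) (smult (mat_norm v) (pderiv p))"
    "\<And>X. (g has_derivative g' X) (at X)" "\<And>v. mat_polynomial C (\<lambda>X. g' X v) (smult (mat_norm v) (pderiv q))"
    by blast
  then show ?case
    by (intro exI[of _ "\<lambda>X v. f' X v + g' X v"])
      (auto intro!: has_derivative_add mat_polynomial.add simp: pderiv_add smult_add_right)
next
  case (mult f p g q)
  then obtain f' g' where
    *: "\<And>X. (f has_derivative f' X) (at X)" "\<And>v. mat_polynomial C (\<lambda>X. f' X v) (smult (mat_norm v) (pderiv p))"
    "\<And>X. (g has_derivative g' X) (at X)" "\<And>v. mat_polynomial C (\<lambda>X. g' X v) (smult (mat_norm v) (pderiv q))"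
    by blast
  have eq: "smult c (pderiv (p * q)) = p * smult c (pderiv q) + smult c (pderiv p) * q" for c
    by (simp add: pderiv_mult smult_add_right mult.commute)
  show ?case
    by (intro exI[of _ "\<lambda>X v. f X ** g' X v + f' X v ** g X"] conjI allI)
      (auto intro!: matmul.FDERIV * mat_polynomial.add mat_polynomial.mult mult.hyps simp only: eq)
qed

text \<open>The Cauchy estimate for majorants: at the price of a slightly larger radius, the derivative of a
majorant is controlled by the majorant itself. The mean value theorem suffices because \<open>p'\<close> is
increasing on the nonnegative reals.\<close>
lemma poly_pderiv_le_difference_quotient:
  fixes p :: "real poly"
  assumes "\<And>i. 0 \<le> coeff p i" "0 \<le> r" "r < \<rho>"
  shows "poly (pderiv p) r \<le> poly p \<rho> / (\<rho> - r)"
proof -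
  obtain \<xi> where \<xi>: "r < \<xi>" "\<xi> < \<rho>" "poly p \<rho> - poly p r = (\<rho> - r) * poly (pderiv p) \<xi>"
    using poly_MVT[OF assms(3)] by blast
  have "poly (pderiv p) r \<le> poly (pderiv p) \<xi>"
    using \<xi> assms by (intro poly_mono_of_coeff_nonneg) (auto simp: coeff_pderiv)
  then have "(\<rho> - r) * poly (pderiv p) r \<le> poly p \<rho> - poly p r"
    using \<xi>(3) assms(3) by simp
  also have "\<dots> \<le> poly p \<rho>"
    using poly_nonneg_of_coeff_nonneg[OF assms(1,2)] by simp
  finally show ?thesis using assms(3) by (simp add: field_simps)
qed

text \<open>The strict inequality leaves room to lose some radius to the Cauchy estimate at every
differentiation.\<close>
definition majorised ::
    "real^'n^'n \<Rightarrow> (real^'n^'n) set \<Rightarrow> (nat \<Rightarrow> real^'n^'n \<Rightarrow> real^'n^'n) \<Rightarrow> (nat \<Rightarrow> real poly) \<Rightarrow> bool" where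
  "majorised C S f p \<longleftrightarrow> (\<forall>k. mat_polynomial C (f k) (p k)) \<and>
     (\<forall>X\<in>S. \<exists>\<rho>>mat_norm (X - C). summable (\<lambda>k. poly (p k) \<rho>))"

lemma majorised_summable:
  assumes "majorised C S f p" "X \<in> S"
  shows "summable (\<lambda>k. f k X)"
proof -
  obtain \<rho> where \<rho>: "\<rho> > mat_norm (X - C)" "summable (\<lambda>k. poly (p k) \<rho>)"
    using assms by (auto simp: majorised_def)
  show ?thesis
  proof (rule summable_if_mat_norm_summable[OF \<rho>(2)])
    fix k
    have pk: "mat_polynomial C (f k) (p k)" using assms by (auto simp: majorised_def)
    have "mat_norm (f k X) \<le> poly (p k) (mat_norm (X - C))" by (rule mat_norm_mat_polynomial_le[OF pk])
    also have "\<dots> \<le> poly (p k) \<rho>"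
      using \<rho> mat_polynomial_coeff_nonneg[OF pk] by (intro poly_mono_of_coeff_nonneg) (auto simp: mat_norm_nonneg)
    finally show "mat_norm (f k X) \<le> poly (p k) \<rho>" .
  qed
qed

text \<open>This closure property is what makes the induction on the order of differentiability work.\<close>
lemma majorised_derivative:
  assumes "majorised C S f p"
    and f': "\<And>k v. mat_polynomial C (\<lambda>X. f' k X v) (smult (mat_norm v) (pderiv (p k)))"
  shows "majorised C S (\<lambda>k X. f' k X v) (\<lambda>k. smult (mat_norm v) (pderiv (p k)))"
  unfolding majorised_def
proof (intro conjI allI ballI)
  fix X assume "X \<in> S"
  then obtain \<rho> where \<rho>: "\<rho> > mat_norm (X - C)" "summable (\<lambda>k. poly (p k) \<rho>)"
    using assms by (auto simp: majorised_def)
  from dense[OF \<rho>(1)] obtain r where r: "mat_norm (X - C) < r" "r < \<rho>" by blast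
  have r0: "0 \<le> r" using r(1) mat_norm_nonneg[of "X - C"] by linarith
  have nn: "0 \<le> coeff (p k) i" for k i
    using assms(1) mat_polynomial_coeff_nonneg unfolding majorised_def by blast
  have "summable (\<lambda>k. poly (pderiv (p k)) r)"
  proof (rule summable_comparison_test')
    show "summable (\<lambda>k. poly (p k) \<rho> / (\<rho> - r))" by (intro summable_divide \<rho>)
    show "norm (poly (pderiv (p k)) r) \<le> poly (p k) \<rho> / (\<rho> - r)" if "0 \<le> k" for k
      using poly_pderiv_le_difference_quotient[OF nn r0 r(2)]
        poly_nonneg_of_coeff_nonneg[of "pderiv (p k)" r] nn r0 by (simp add: coeff_pderiv)
  qed
  then show "\<exists>\<rho>>mat_norm (X - C). summable (\<lambda>k. poly (smult (mat_norm v) (pderiv (p k))) \<rho>)"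
    using r by (auto intro!: exI[of _ r] summable_mult)
qed (rule f')

text \<open>Termwise differentiation: the Cauchy estimate bounds the differentiated terms by a summable sequence,
uniformly on a ball around \<open>C\<close> that contains the given point.\<close>
lemma majorised_has_derivative:
  fixes f :: "nat \<Rightarrow> real^'n^'n \<Rightarrow> real^'n^'n"
  assumes maj: "majorised C S f p" and X0: "X0 \<in> S"
    and f: "\<And>k X. (f k has_derivative f' k X) (at X)"
    and f': "\<And>k v. mat_polynomial C (\<lambda>X. f' k X v) (smult (mat_norm v) (pderiv (p k)))"
  shows "((\<lambda>X. \<Sum>k. f k X) has_derivative (\<lambda>v. \<Sum>k. f' k X0 v)) (at X0)"
proof -
  (* the constant that compares the induced norm with the Frobenius norm, in both directions *)
  define N where "N = (real CARD('n))\<^sup>2"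
  have N: "N > 0" by (simp add: N_def)
  obtain \<rho> where \<rho>: "\<rho> > mat_norm (X0 - C)" "summable (\<lambda>k. poly (p k) \<rho>)"
    using maj X0 by (auto simp: majorised_def)
  from dense[OF \<rho>(1)] obtain r where r: "mat_norm (X0 - C) < r" "r < \<rho>" by blast
  define U where "U = mat_ball C r"
  have U: "open U" "convex U" "X0 \<in> U" 
    using r by (simp_all add: U_def open_mat_ball convex_mat_ball in_mat_ball)
  have majU: "majorised C U f p"
    unfolding majorised_def
  proof (intro conjI allI ballI)
    show "\<exists>\<rho>>mat_norm (X - C). summable (\<lambda>k. poly (p k) \<rho>)" if "X \<in> U" for X
      using that r \<rho> by (intro exI[of _ \<rho>]) (simp add: U_def in_mat_ball)
  qed (use maj in \<open>auto simp: majorised_def\<close>)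
  have nn: "0 \<le> coeff (p k) i" for k i
    using maj mat_polynomial_coeff_nonneg unfolding majorised_def by blast
  define b where "b k = poly (p k) \<rho> / (\<rho> - r)" for k
  have b0: "0 \<le> b k" for k
    unfolding b_def using nn r \<rho> mat_norm_nonneg[of "X0 - C"]
    by (intro divide_nonneg_nonneg poly_nonneg_of_coeff_nonneg) simp_all
  have b: "summable b" unfolding b_def by (intro summable_divide \<rho>)
  have r0: "0 \<le> r" using r(1) mat_norm_nonneg[of "X0 - C"] by linarith
  have bound: "mat_norm (f' k X v) \<le> mat_norm v * b k" if "X \<in> U" for k X v
  proof -
    have "mat_norm (f' k X v) \<le> mat_norm v * poly (pderiv (p k)) (mat_norm (X - C))"
      using mat_norm_mat_polynomial_le[OF f', of k X v] by simp
    also have "\<dots> \<le> mat_norm v * poly (pderiv (p k)) r"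
      using nn that by (intro mult_left_mono poly_mono_of_coeff_nonneg)
        (auto simp: coeff_pderiv mat_norm_nonneg U_def in_mat_ball)
    also have "\<dots> \<le> mat_norm v * b k"
      unfolding b_def
      using nn r0 r(2) by (intro mult_left_mono poly_pderiv_le_difference_quotient) (auto simp: mat_norm_nonneg)
    finally show ?thesis .
  qed
  have sf': "summable (\<lambda>k. f' k X v)" if "X \<in> U" for X v
    using majorised_summable[OF majorised_derivative[OF majU f'] that] .
  have unif: "\<forall>\<^sub>F n in sequentially. \<forall>X\<in>U. \<forall>v.
      norm ((\<Sum>i<n. f' i X v) - (\<Sum>k. f' k X v)) \<le> e * norm v" if e: "e > 0" for e
  proof -
    obtain M where M: "\<And>n. n \<ge> M \<Longrightarrow> norm (\<Sum>i. b (i + n)) < e / (N * N)"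
      using suminf_exist_split[OF _ b, of "e / (N * N)"] e N by auto
    have "norm ((\<Sum>i<n. f' i X v) - (\<Sum>k. f' k X v)) \<le> e * norm v"
      if n: "n \<ge> M" and X: "X \<in> U" for n X v
    proof -
      have tail: "(\<lambda>k. f' (k + n) X v) sums ((\<Sum>k. f' k X v) - (\<Sum>i<n. f' i X v))"
        using sums_split_initial_segment[OF summable_sums[OF sf'[OF X]]] .
      have "mat_norm ((\<Sum>k. f' k X v) - (\<Sum>i<n. f' i X v)) \<le> mat_norm v * (\<Sum>i. b (i + n))"
      proof (rule mat_norm_sums_le[OF tail])
        show "(\<lambda>k. mat_norm v * b (k + n)) sums (mat_norm v * (\<Sum>i. b (i + n)))"
          using b by (intro sums_mult summable_sums) simp
      qed (rule bound[OF X])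
      also have "\<dots> \<le> N * norm v * (e / (N * N))"
      proof (rule mult_mono)
        show "(\<Sum>i. b (i + n)) \<le> e / (N * N)" using M[OF n] by simp
        show "mat_norm v \<le> N * norm v" using mat_norm_le_norm[of v] by (simp add: N_def)
        show "0 \<le> (\<Sum>i. b (i + n))"
          using b b0 by (intro suminf_nonneg) simp_all
      qed (use N in simp)
      finally have "mat_norm ((\<Sum>k. f' k X v) - (\<Sum>i<n. f' i X v)) \<le> e * norm v / N"
        using N by (simp add: field_simps)
      then have "N * mat_norm ((\<Sum>k. f' k X v) - (\<Sum>i<n. f' i X v)) \<le> N * (e * norm v / N)"
        using N by (intro mult_left_mono) simp_all
      then have "norm ((\<Sum>k. f' k X v) - (\<Sum>i<n. f' i X v)) \<le> N * (e * norm v / N)"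
        using norm_le_mat_norm[of "(\<Sum>k. f' k X v) - (\<Sum>i<n. f' i X v)"]
        unfolding N_def[symmetric] by linarith
      then show ?thesis using N by (simp add: norm_minus_commute)
    qed
    then show ?thesis unfolding eventually_sequentially by blast
  qed
  have "\<exists>g. \<forall>X\<in>U. (\<lambda>k. f k X) sums g X \<and> (g has_derivative (\<lambda>v. \<Sum>k. f' k X v)) (at X within U)"
    by (rule has_derivative_series[OF U(2) has_derivative_at_withinI[OF f] unif U(3)
          summable_sums[OF majorised_summable[OF majU U(3)]]])
  then obtain g where g: "\<And>X. X \<in> U \<Longrightarrow> (\<lambda>k. f k X) sums g X"
      "(g has_derivative (\<lambda>v. \<Sum>k. f' k X0 v)) (at X0 within U)"
    using U by blast
  have "(g has_derivative (\<lambda>v. \<Sum>k. f' k X0 v)) (at X0)"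
    using g(2) unfolding at_within_open[OF U(3,1)] .
  then show ?thesis
    by (rule has_derivative_transform_within_open[OF _ U(1,3) sums_unique[OF g(1)]])
qed

section \<open>Smoothness of majorised series\<close>

lemma majorised_termwise_derivative:
  assumes "majorised C S f p"
  shows "\<exists>f'. (\<forall>k X. (f k has_derivative f' k X) (at X)) \<and>
    (\<forall>k v. mat_polynomial C (\<lambda>X. f' k X v) (smult (mat_norm v) (pderiv (p k))))"
proof -
  have "\<forall>k. \<exists>f'. (\<forall>X. (f k has_derivative f' X) (at X)) \<and>
    (\<forall>v. mat_polynomial C (\<lambda>X. f' X v) (smult (mat_norm v) (pderiv (p k))))"
    using assms by (auto simp: majorised_def intro: mat_polynomial_has_derivative)
  from choice[OF this] obtain F where F: "\<forall>k. (\<forall>X. (f k has_derivative F k X) (at X)) \<and>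
    (\<forall>v. mat_polynomial C (\<lambda>X. F k X v) (smult (mat_norm v) (pderiv (p k))))" ..
  show ?thesis
    by (rule exI[of _ F]) (use F in simp)
qed

lemma Ck_on_cong:
  assumes "open S" "\<And>x. x \<in> S \<Longrightarrow> f x = g x" "Ck_on k S f"
  shows "Ck_on k S g"
  using assms(2,3)
proof (induction k arbitrary: f g)
  case 0
  then show ?case by (simp cong: continuous_on_cong)
next
  case (Suc k)
  have der: "(g has_derivative frechet_derivative f (at x)) (at x)" if x: "x \<in> S" for x
  proof (rule has_derivative_transform_within_open[OF _ assms(1) x])
    show "(f has_derivative frechet_derivative f (at x)) (at x)"
      using Suc.prems(2) x frechet_derivative_works by auto
  qed (rule Suc.prems(1))
  have eq: "frechet_derivative f (at x) = frechet_derivative g (at x)" if "x \<in> S" for x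
    by (rule frechet_derivative_at[OF der[OF that]])
  have "Ck_on k S (\<lambda>x. frechet_derivative g (at x) v)" for v
    by (rule Suc.IH[of "\<lambda>x. frechet_derivative f (at x) v"]) (use Suc.prems(2) in \<open>simp_all add: eq\<close>)
  moreover have "\<forall>x\<in>S. g differentiable (at x)"
    using der unfolding differentiable_def by blast
  ultimately show ?case by simp
qed

lemma majorised_Ck_on:
  assumes "open S" "majorised C S f p"
  shows "Ck_on k S (\<lambda>X. \<Sum>k. f k X)"
  using assms(2)
proof (induction k arbitrary: f p)
  case (0 f p)
  from majorised_termwise_derivative[OF this]
  obtain f' where *: "\<forall>k X. (f k has_derivative f' k X) (at X)"
    "\<forall>k v. mat_polynomial C (\<lambda>X. f' k X v) (smult (mat_norm v) (pderiv (p k)))"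
    by (elim exE conjE)
  note f' = *(1)[rule_format] *(2)[rule_format]
  have "continuous (at X) (\<lambda>X. \<Sum>k. f k X)" if "X \<in> S" for X
    by (rule has_derivative_continuous[OF majorised_has_derivative[OF 0 that f']])
  then show ?case by (simp add: continuous_at_imp_continuous_on)
next
  case (Suc k f p)
  from majorised_termwise_derivative[OF Suc.prems]
  obtain f' where *: "\<forall>k X. (f k has_derivative f' k X) (at X)"
    "\<forall>k v. mat_polynomial C (\<lambda>X. f' k X v) (smult (mat_norm v) (pderiv (p k)))"
    by (elim exE conjE)
  note f' = *(1)[rule_format] *(2)[rule_format]
  note der = majorised_has_derivative[OF Suc.prems _ f']
  have eq: "frechet_derivative (\<lambda>X. \<Sum>k. f k X) (at X) = (\<lambda>v. \<Sum>k. f' k X v)" if "X \<in> S" for X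
    using frechet_derivative_at[OF der[OF that]] by simp
  have "Ck_on k S (\<lambda>X. frechet_derivative (\<lambda>X. \<Sum>k. f k X) (at X) v)" for v
    by (rule Ck_on_cong[OF assms(1) _ Suc.IH[OF majorised_derivative[OF Suc.prems f'(2), of v]]])
      (simp add: eq)
  moreover have "\<forall>X\<in>S. (\<lambda>X. \<Sum>k. f k X) differentiable (at X)"
    using der unfolding differentiable_def by blast
  ultimately show ?case by simp
qed

section \<open>Matrix power series\<close>

definition mat_series :: "(nat \<Rightarrow> real) \<Rightarrow> real^'n^'n \<Rightarrow> real^'n^'n" where
  "mat_series c Z = (\<Sum>k. c k *\<^sub>R mat_power Z k)"

primrec mat_power_deriv :: "real^'n^'n \<Rightarrow> real^'n^'n \<Rightarrow> nat \<Rightarrow> real^'n^'n" where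
  "mat_power_deriv Z V 0 = 0"
| "mat_power_deriv Z V (Suc k) = Z ** mat_power_deriv Z V k + V ** mat_power Z k"

lemma mat_power_has_derivative:
  "((\<lambda>X. mat_power (X - C) k) has_derivative (\<lambda>V. mat_power_deriv (X - C) V k)) (at X)"
proof (induction k)
  case (Suc k)
  show ?case
    by (auto intro!: derivative_eq_intros matmul.FDERIV Suc)
qed simp

lemma mat_power_deriv_commuting:
  assumes "Z ** V = V ** Z"
  shows "mat_power_deriv Z V (Suc k) = real (Suc k) *\<^sub>R (mat_power Z k ** V)"
proof (induction k)
  case (Suc k)
  have "mat_power_deriv Z V (Suc (Suc k)) = Z ** (real (Suc k) *\<^sub>R (mat_power Z k ** V)) + V ** mat_power Z (Suc k)"
    using Suc by simp
  also have "V ** mat_power Z (Suc k) = mat_power Z (Suc k) ** V"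
    by (rule mat_power_commute) (simp add: assms)
  finally show ?case
    by (simp add: matmul.scaleR_right matmul.add_right matrix_mul_assoc scaleR_left_distrib scaleR_2)
qed simp

lemma mat_polynomial_power:
  "mat_polynomial C (\<lambda>X. c *\<^sub>R mat_power (X - C) k) (smult \<bar>c\<bar> (monom 1 k))"
proof -
  have "mat_polynomial C (\<lambda>X. mat_power (X - C) k) (monom 1 k)"
  proof (induction k)
    case 0
    show ?case using mat_polynomial.const[of C "mat 1"] by (simp add: monom_0)
  next
    case (Suc k)
    from mat_polynomial.mult[OF mat_polynomial.shift this] show ?case by (simp add: monom_Suc)
  qed
  from mat_polynomial.mult[OF mat_polynomial.const[of C "c *\<^sub>R mat 1"] this]
  show ?thesis by (simp add: matmul.scaleR_left mat_norm_scaleR)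
qed

lemma mat_series_majorised:
  assumes "\<And>X. X \<in> S \<Longrightarrow> \<exists>\<rho>>mat_norm (X - C). summable (\<lambda>k. \<bar>c k\<bar> * \<rho> ^ k)"
  shows "majorised C S (\<lambda>k X. c k *\<^sub>R mat_power (X - C) k) (\<lambda>k. smult \<bar>c k\<bar> (monom 1 k))"
  using assms unfolding majorised_def by (auto simp: poly_monom mat_polynomial_power)

lemma mat_series_Ck_on:
  assumes "open S" "\<And>X. X \<in> S \<Longrightarrow> \<exists>\<rho>>mat_norm (X - C). summable (\<lambda>k. \<bar>c k\<bar> * \<rho> ^ k)"
  shows "Ck_on k S (\<lambda>X. mat_series c (X - C))"
  unfolding mat_series_def by (rule majorised_Ck_on[OF assms(1) mat_series_majorised[OF assms(2)]])

lemma mat_series_sums: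
  assumes "\<exists>\<rho>>mat_norm Z. summable (\<lambda>k. \<bar>c k\<bar> * \<rho> ^ k)"
  shows "(\<lambda>k. c k *\<^sub>R mat_power Z k) sums mat_series c Z"
  unfolding mat_series_def
  using majorised_summable[OF mat_series_majorised[of "{Z}" 0 c], of Z] assms
  by (simp add: summable_sums)

text \<open>For directions that commute with the base point the order of the factors is irrelevant, and the
derivative is given by the scalar rule. All derivatives computed explicitly in the sequel (the
logarithm along \<open>E log E\<close>, the exponential along a ray) are of this kind.\<close>
lemma mat_series_has_derivative:
  fixes Z :: "real^'n^'n"
  assumes "\<exists>\<rho>>mat_norm Z. summable (\<lambda>k. \<bar>c k\<bar> * \<rho> ^ k)"
  obtains D where "(mat_series c has_derivative D) (at Z)"
    "\<And>V. Z ** V = V ** Z \<Longrightarrow> D V = mat_series (diffs c) Z ** V"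
proof -
  define D where "D V = (\<Sum>k. c k *\<^sub>R mat_power_deriv Z V k)" for V
  have maj: "majorised 0 {Z} (\<lambda>k X. c k *\<^sub>R mat_power (X - 0) k) (\<lambda>k. smult \<bar>c k\<bar> (monom 1 k))"
    by (rule mat_series_majorised) (use assms in simp)
  have f: "((\<lambda>X. c k *\<^sub>R mat_power (X - 0) k) has_derivative (\<lambda>V. c k *\<^sub>R mat_power_deriv X V k)) (at X)"
    for k and X :: "real^'n^'n"
    using mat_power_has_derivative[of 0 k X] by (auto intro!: has_derivative_scaleR_right)
  have f': "mat_polynomial 0 (\<lambda>X. c k *\<^sub>R mat_power_deriv X v k)
      (smult (mat_norm v) (pderiv (smult \<bar>c k\<bar> (monom 1 k))))"
    for k and v :: "real^'n^'n"
  proof -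
    from mat_polynomial_has_derivative[OF mat_polynomial_power[of 0 "c k" k]]
    obtain F where F: "(\<forall>X. ((\<lambda>X. c k *\<^sub>R mat_power (X - 0) k) has_derivative F X) (at X)) \<and>
      (\<forall>v :: real^'n^'n. mat_polynomial 0 (\<lambda>X. F X v) (smult (mat_norm v) (pderiv (smult \<bar>c k\<bar> (monom 1 k)))))" ..
    have "F X = (\<lambda>V. c k *\<^sub>R mat_power_deriv X V k)" for X
      by (rule has_derivative_unique[OF conjunct1[OF F, rule_format] f])
    with F show ?thesis by simp
  qed
  note der = majorised_has_derivative[OF maj singletonI f f']
  have 1: "(mat_series c has_derivative D) (at Z)"
    using der by (simp add: mat_series_def[abs_def] D_def[abs_def])
  have 2: "D V = mat_series (diffs c) Z ** V" if V: "Z ** V = V ** Z" for V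
  proof -
    have sm: "summable (\<lambda>k. c k *\<^sub>R mat_power_deriv Z V k)" for V
      using majorised_summable[OF majorised_derivative[OF maj f'] singletonI] .
    have *: "c (Suc k) *\<^sub>R mat_power_deriv Z V (Suc k) = diffs c k *\<^sub>R (mat_power Z k ** V)"
      if "Z ** V = V ** Z" for k V
      unfolding mat_power_deriv_commuting[OF that] by (simp add: diffs_def algebra_simps)
    (* the direction mat 1 commutes with everything, so it yields the convergence of the series for diffs c *)
    have "summable (\<lambda>k. c (Suc k) *\<^sub>R mat_power_deriv Z (mat 1) (Suc k))"
      using sm by (subst summable_Suc_iff)
    then have "summable (\<lambda>k. diffs c k *\<^sub>R mat_power Z k)"
      by (subst (asm) *) simp_all
    then have "(\<lambda>k. diffs c k *\<^sub>R mat_power Z k) sums mat_series (diffs c) Z"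
      by (simp add: mat_series_def summable_sums)
    from matmul.bounded_linear_left[THEN bounded_linear.sums, OF this, of V]
    have "(\<lambda>k. c (Suc k) *\<^sub>R mat_power_deriv Z V (Suc k)) sums (mat_series (diffs c) Z ** V)"
      by (simp only: * V matmul.scaleR_left)
    then have "(\<lambda>k. c k *\<^sub>R mat_power_deriv Z V k) sums (mat_series (diffs c) Z ** V)"
      using sums_Suc_iff[of "\<lambda>k. c k *\<^sub>R mat_power_deriv Z V k"] by (simp del: mat_power_deriv.simps(2))
    then show ?thesis by (simp add: D_def sums_iff)
  qed
  show ?thesis by (rule that[OF 1 2])
qed

lemma mat_series_commute:
  assumes "\<exists>\<rho>>mat_norm Z. summable (\<lambda>k. \<bar>c k\<bar> * \<rho> ^ k)" "A ** Z = Z ** A"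
  shows "A ** mat_series c Z = mat_series c Z ** A"
proof -
  have "(\<lambda>k. A ** (c k *\<^sub>R mat_power Z k)) sums (A ** mat_series c Z)"
    by (rule matmul.bounded_linear_right[THEN bounded_linear.sums, OF mat_series_sums[OF assms(1)]])
  moreover have "(\<lambda>k. (c k *\<^sub>R mat_power Z k) ** A) sums (mat_series c Z ** A)"
    by (rule matmul.bounded_linear_left[THEN bounded_linear.sums, OF mat_series_sums[OF assms(1)]])
  ultimately show ?thesis
    by (simp add: matmul.scaleR_left matmul.scaleR_right mat_power_commute[OF assms(2)] sums_iff)
qed

lemma mat_series_vector_derivative:
  assumes \<rho>: "\<exists>\<rho>>mat_norm (g t). summable (\<lambda>k. \<bar>c k\<bar> * \<rho> ^ k)"
    and g: "(g has_vector_derivative g') (at t within T)" and comm: "g t ** g' = g' ** g t"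
  shows "((\<lambda>t. mat_series c (g t)) has_vector_derivative (mat_series (diffs c) (g t) ** g')) (at t within T)"
proof -
  obtain D where D: "(mat_series c has_derivative D) (at (g t))"
    "\<And>V. g t ** V = V ** g t \<Longrightarrow> D V = mat_series (diffs c) (g t) ** V"
    using mat_series_has_derivative[OF \<rho>] by blast
  have "((\<lambda>t. mat_series c (g t)) has_vector_derivative D g') (at t within T)"
    using vector_derivative_diff_chain_within[OF g has_derivative_at_withinI[OF D(1)]] by (simp add: o_def)
  then show ?thesis by (simp add: D(2) comm)
qed

text \<open>Coefficients of \<open>exp z\<close>, \<open>ln (1 + z)\<close> and \<open>1 / (1 + z)\<close>; the constant term of the logarithm is
\<open>- 1 / 0 = 0\<close>.\<close>
definition exp_coeff :: "nat \<Rightarrow> real" where "exp_coeff k = 1 / fact k"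
definition log_coeff :: "nat \<Rightarrow> real" where "log_coeff k = (-1) ^ Suc k / of_nat k"
definition inv_coeff :: "nat \<Rightarrow> real" where "inv_coeff k = (-1) ^ k"

lemma mat_exp_series: "mat_exp = mat_series exp_coeff"
  by (rule ext) (simp add: mat_exp_def mat_series_def exp_coeff_def)

lemma diffs_exp_coeff: "diffs exp_coeff = exp_coeff"
  by (rule ext) (simp add: diffs_def exp_coeff_def del: of_nat_Suc)

lemma diffs_log_coeff: "diffs log_coeff = inv_coeff"
  by (rule ext) (simp add: diffs_def log_coeff_def inv_coeff_def del: of_nat_Suc)

lemma exp_radius: "\<exists>\<rho>>x. summable (\<lambda>k. \<bar>exp_coeff k\<bar> * \<rho> ^ k)"
  using summable_exp[of "x + 1"] by (intro exI[of _ "x + 1"]) (simp add: inverse_eq_divide exp_coeff_def)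

lemma inv_radius:
  assumes "0 \<le> x" "x < 1"
  shows "\<exists>\<rho>>x. summable (\<lambda>k. \<bar>inv_coeff k\<bar> * \<rho> ^ k)"
proof -
  from dense[OF assms(2)] obtain r where "x < r" "r < 1" by blast
  with assms show ?thesis by (intro exI[of _ r]) (simp add: power_abs inv_coeff_def)
qed

lemma log_radius:
  assumes "0 \<le> x" "x < 1"
  shows "\<exists>\<rho>>x. summable (\<lambda>k. \<bar>log_coeff k\<bar> * \<rho> ^ k)"
proof -
  from dense[OF assms(2)] obtain r where r: "x < r" "r < 1" by blast
  have "summable (\<lambda>k. \<bar>log_coeff k\<bar> * r ^ k)"
  proof (rule summable_comparison_test')
    show "summable (\<lambda>k. r ^ k)" using r assms by simp
    show "norm (\<bar>log_coeff k\<bar> * r ^ k) \<le> r ^ k" if "0 \<le> k" for k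
      using r assms by (cases "k = 0") (auto simp: log_coeff_def power_abs divide_simps mult_le_cancel_left1)
  qed
  with r show ?thesis by blast
qed

section \<open>The exponential inverts the logarithm series\<close>

abbreviation log1p :: "real^'n^'n \<Rightarrow> real^'n^'n" where "log1p \<equiv> mat_series log_coeff"

lemma mat_series_0: "mat_series c 0 = (c 0 *\<^sub>R mat 1 :: real^'n^'n)"
proof -
  have "c k *\<^sub>R mat_power 0 k = (if k = 0 then c 0 *\<^sub>R mat 1 else 0 :: real^'n^'n)" for k
    by (cases k) auto
  then show ?thesis
    unfolding mat_series_def using sums_unique[OF sums_single[of 0 "\<lambda>_. c 0 *\<^sub>R mat 1 :: real^'n^'n"], symmetric] by simp
qed

lemma inv_series_inverse:
  assumes "mat_norm Y < 1"
  shows "mat_series inv_coeff Y ** (mat 1 + Y) = mat 1"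
proof -
  have s: "(\<lambda>k. inv_coeff k *\<^sub>R mat_power Y k) sums mat_series inv_coeff Y"
    by (rule mat_series_sums[OF inv_radius[OF mat_norm_nonneg assms]])
  from matmul.bounded_linear_left[THEN bounded_linear.sums, OF this, of Y]
  have "(\<lambda>k. - (inv_coeff (Suc k) *\<^sub>R mat_power Y (Suc k))) sums (mat_series inv_coeff Y ** Y)"
    by (simp only: mat_power_Suc2 matmul.scaleR_left) (simp add: inv_coeff_def)
  then have "(\<lambda>k. inv_coeff (Suc k) *\<^sub>R mat_power Y (Suc k)) sums (- (mat_series inv_coeff Y ** Y))"
    using sums_minus by fastforce
  then have "(\<lambda>k. inv_coeff k *\<^sub>R mat_power Y k) sums (- (mat_series inv_coeff Y ** Y) + mat 1)"
    by (subst (asm) sums_Suc_iff) (simp add: inv_coeff_def)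
  from sums_unique2[OF s this] show ?thesis
    by (simp add: matmul.add_right eq_diff_eq)
qed

text \<open>With \<open>H t = exp (log (1 + t Y))\<close> and \<open>R t = (1 + t Y)\<^sup>-\<^sup>1\<close>, the derivatives are \<open>H' = H R Y\<close> (everything
commutes) and \<open>R' = - R Y R\<close> (differentiate \<open>R (1 + t Y) = 1\<close>). Hence \<open>H R\<close> is constant, equal to
its value 1 at \<open>t = 0\<close>.\<close>
theorem mat_exp_log1p:
  assumes Y: "mat_norm Y < 1"
  shows "mat_exp (log1p Y) = mat 1 + Y"
proof -
  define R where "R t = mat_series inv_coeff (t *\<^sub>R Y)" for t
  define H where "H t = mat_exp (log1p (t *\<^sub>R Y))" for t
  have tY: "mat_norm (t *\<^sub>R Y) < 1" if "t \<in> {0..1}" for t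
    using that Y mat_norm_nonneg[of Y] by (simp add: mat_norm_scaleR) (metis mult_left_le_one_le order_le_less_trans)
  have commY: "Y ** mat_series c (t *\<^sub>R Y) = mat_series c (t *\<^sub>R Y) ** Y"
    if "\<exists>\<rho>>mat_norm (t *\<^sub>R Y). summable (\<lambda>k. \<bar>c k\<bar> * \<rho> ^ k)" for c t
    by (rule mat_series_commute[OF that]) (simp add: matmul.scaleR_left matmul.scaleR_right)
  have gd: "((\<lambda>t. t *\<^sub>R Y) has_vector_derivative Y) (at t within {0..1})" for t
    by (auto intro!: derivative_eq_intros)
  have inv: "R t ** (mat 1 + t *\<^sub>R Y) = mat 1" if "t \<in> {0..1}" for t
    unfolding R_def by (rule inv_series_inverse[OF tY[OF that]])
  have const: "((\<lambda>t. H t ** R t) has_vector_derivative 0) (at t within {0..1})" if t: "t \<in> {0..1}" for t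
  proof -
    note rad = log_radius[OF mat_norm_nonneg tY[OF t]] inv_radius[OF mat_norm_nonneg tY[OF t]]
    have YR: "Y ** R t = R t ** Y" unfolding R_def by (rule commY[OF rad(2)])
    have L: "((\<lambda>t. log1p (t *\<^sub>R Y)) has_vector_derivative (R t ** Y)) (at t within {0..1})"
      using mat_series_vector_derivative[OF rad(1) gd] 
      by (simp add: diffs_log_coeff R_def matmul.scaleR_left matmul.scaleR_right)
    have "Y ** log1p (t *\<^sub>R Y) = log1p (t *\<^sub>R Y) ** Y" by (rule commY[OF rad(1)])
    moreover have "R t ** log1p (t *\<^sub>R Y) = log1p (t *\<^sub>R Y) ** R t"
      by (rule mat_series_commute[OF rad(1)]) (simp add: matmul.scaleR_left matmul.scaleR_right YR)
    ultimately have "log1p (t *\<^sub>R Y) ** (R t ** Y) = (R t ** Y) ** log1p (t *\<^sub>R Y)"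
      by (metis matrix_mul_assoc)
    then have H: "(H has_vector_derivative (H t ** (R t ** Y))) (at t within {0..1})"
      using mat_series_vector_derivative[OF exp_radius L]
      unfolding H_def mat_exp_series diffs_exp_coeff by simp
    obtain R' where R': "(R has_vector_derivative R') (at t within {0..1})"
      using mat_series_vector_derivative[OF rad(2) gd] unfolding R_def
      by (auto simp: matmul.scaleR_left matmul.scaleR_right)
    have "((\<lambda>t. R t ** (mat 1 + t *\<^sub>R Y)) has_vector_derivative (R t ** Y + R' ** (mat 1 + t *\<^sub>R Y))) (at t within {0..1})"
      by (rule matmul.has_vector_derivative[OF R']) (auto intro!: derivative_eq_intros)
    moreover have "((\<lambda>t. R t ** (mat 1 + t *\<^sub>R Y)) has_vector_derivative 0) (at t within {0..1})"
      by (rule has_vector_derivative_transform[OF t inv has_vector_derivative_const]) 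
    ultimately have "R t ** Y + R' ** (mat 1 + t *\<^sub>R Y) = 0"
      using t by (intro vector_derivative_unique_within[where S="{0..1}" and x=t])
        (auto simp: trivial_limit_within islimpt_Icc)
    then have "(R t ** Y + R' ** (mat 1 + t *\<^sub>R Y)) ** R t = 0" by simp
    moreover have "(mat 1 + t *\<^sub>R Y) ** R t = mat 1"
      using inv[OF t] matrix_left_right_inverse by blast
    ultimately have "R t ** Y ** R t + R' = 0"
      by (simp add: matmul.add_left flip: matrix_mul_assoc)
    then have "H t ** R' + (H t ** (R t ** Y)) ** R t = 0"
      by (metis add.commute matmul.add_right matmul.zero_right matrix_mul_assoc)
    with matmul.has_vector_derivative[OF H R'] show ?thesis by simp
  qed
  obtain K where K: "\<And>t. t \<in> {0..1} \<Longrightarrow> H t ** R t = K"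
    using has_vector_derivative_zero_constant[OF convex_real_interval(5) const] by blast
  have "H 0 ** R 0 = mat 1"
    by (simp add: H_def R_def mat_series_0 mat_exp_series exp_coeff_def log_coeff_def inv_coeff_def)
  then have 1: "H 1 ** R 1 = mat 1" using K[of 0] K[of 1] by simp
  have "H 1 = H 1 ** (R 1 ** (mat 1 + Y))" using inv[of 1] by simp
  also have "\<dots> = mat 1 + Y" by (simp add: matrix_mul_assoc 1)
  finally show ?thesis by (simp add: H_def)
qed

section \<open>Eigenvectors in invariant subspaces\<close>

text \<open>\<open>poly_act M v p\<close> is \<open>p(M) v\<close>, evaluated by Horner's rule.\<close>
definition poly_act :: "complex^'n^'n \<Rightarrow> complex^'n \<Rightarrow> complex poly \<Rightarrow> complex^'n" where
  "poly_act M v p = fold_coeffs (\<lambda>a u. a *s v + M *v u) p 0"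

lemma poly_act_0 [simp]: "poly_act M v 0 = 0"
  by (simp add: poly_act_def)

lemma poly_act_pCons: "poly_act M v (pCons a p) = a *s v + M *v poly_act M v p"
  by (cases "p = 0 \<and> a = 0") (auto simp: poly_act_def)

lemma poly_act_add: "poly_act M v (p + q) = poly_act M v p + poly_act M v q"
  by (induction p q rule: poly_induct2)
    (simp_all add: poly_act_pCons matrix_vector_right_distrib vec.scale_left_distrib)

lemma poly_act_smult: "poly_act M v (smult c p) = c *s poly_act M v p"
  by (induction p) (simp_all add: poly_act_pCons vector_scalar_commute vec.scale_right_distrib)

lemma poly_act_sum: "poly_act M v (\<Sum>i\<in>I. p i) = (\<Sum>i\<in>I. poly_act M v (p i))"
  by (induction I rule: infinite_finite_induct) (simp_all add: poly_act_add)

lemma poly_act_linear_factor: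
  "poly_act M v ([:- \<alpha>, 1:] * q) = M *v poly_act M v q - \<alpha> *s poly_act M v q"
proof -
  have "[:- \<alpha>, 1:] * q = pCons 0 q + smult (- \<alpha>) q" by simp
  then have "poly_act M v ([:- \<alpha>, 1:] * q) = 0 *s v + M *v poly_act M v q + (- \<alpha>) *s poly_act M v q"
    by (simp only: poly_act_add poly_act_smult poly_act_pCons)
  then show ?thesis by simp
qed

lemma poly_act_in_invariant_subspace:
  assumes "vec.subspace S" "\<And>u. u \<in> S \<Longrightarrow> M *v u \<in> S" "v \<in> S"
  shows "poly_act M v p \<in> S"
  using assms
  by (induction p) (simp_all add: poly_act_pCons vec.subspace_0 vec.subspace_add vec.subspace_scale)

text \<open>The \<open>n + 1\<close> vectors \<open>v, M v, \<dots>, M\<^sup>n v\<close> of an \<open>n\<close>-dimensional space either repeat or are linearly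
dependent.\<close>
lemma annihilating_poly_exists:
  fixes M :: "complex^'n^'n"
  obtains p where "p \<noteq> 0" "poly_act M v p = 0"
proof -
  define n where "n = CARD('n)"
  define w where "w i = poly_act M v (monom 1 i)" for i
  show ?thesis
  proof (cases "inj_on w {..n}")
    case False
    then obtain i j where ij: "w i = w j" "i \<noteq> j" by (auto simp: inj_on_def)
    show ?thesis
    proof (rule that)
      have "coeff (monom 1 i + smult (- 1) (monom 1 j)) i = (1::complex)" using ij by simp
      then show "monom 1 i + smult (- 1) (monom 1 j) \<noteq> (0 :: complex poly)"
        by (metis coeff_0 zero_neq_one)
      show "poly_act M v (monom 1 i + smult (- 1) (monom 1 j)) = 0"
        using ij by (simp only: poly_act_add poly_act_smult w_def) simp
    qed
  next
    case True
    have "vec.dim (w ` {..n}) \<le> n"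
      using vec.dim_subset_UNIV[of "w ` {..n}"] by (simp add: n_def vec.dimension_def card_cart_basis)
    then have "vec.dependent (w ` {..n})"
      by (intro vec.dependent_biggerset_general) (simp add: card_image[OF True])
    then obtain u where u: "\<exists>x\<in>w ` {..n}. u x \<noteq> 0" "(\<Sum>x\<in>w ` {..n}. u x *s x) = 0"
      by (subst (asm) vec.dependent_finite) auto
    define p where "p = (\<Sum>i\<le>n. smult (u (w i)) (monom 1 i))"
    show ?thesis
    proof (rule that)
      obtain i where i: "i \<le> n" "u (w i) \<noteq> 0" using u(1) by auto
      have "coeff p i = (\<Sum>j\<le>n. if j = i then u (w j) else 0)"
        unfolding p_def coeff_sum by (intro sum.cong) auto
      with i show "p \<noteq> 0" by auto
      have "poly_act M v p = (\<Sum>i\<le>n. u (w i) *s w i)"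
        by (simp add: p_def poly_act_sum poly_act_smult w_def)
      also have "\<dots> = 0" using u(2) by (simp add: sum.reindex[OF True])
      finally show "poly_act M v p = 0" .
    qed
  qed
qed

text \<open>Split an annihilating polynomial of \<open>v\<close> into linear factors; the last nonzero vector met when the
factors are applied one after another is an eigenvector.\<close>
lemma eigenvector_in_invariant_subspace:
  fixes M :: "complex^'n^'n"
  assumes S: "vec.subspace S" "\<And>u. u \<in> S \<Longrightarrow> M *v u \<in> S" and v: "v \<in> S" "v \<noteq> 0"
  obtains u \<alpha> where "u \<in> S" "u \<noteq> 0" "M *v u = \<alpha> *s u"
proof -
  have "\<exists>q \<alpha>. poly_act M v q \<noteq> 0 \<and> M *v poly_act M v q = \<alpha> *s poly_act M v q"
    if "p \<noteq> 0" "poly_act M v p = 0" for p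
    using that
  proof (induction "degree p" arbitrary: p)
    case 0
    from degree_eq_zeroE[OF 0(1)[symmetric]] obtain c where "p = [:c:]" by blast
    with 0 v show ?case by (simp add: poly_act_pCons)
  next
    case (Suc d)
    then have "\<not> constant (poly p)" by (simp add: constant_degree)
    from fundamental_theorem_of_algebra[OF this] obtain \<alpha> where "poly p \<alpha> = 0" by blast
    then obtain q where q: "p = [:- \<alpha>, 1:] * q" by (metis poly_eq_0_iff_dvd dvdE)
    then have "q \<noteq> 0" using Suc.prems by auto
    then have "degree p = Suc (degree q)"
      unfolding q by (subst degree_mult_eq) auto
    then have d: "d = degree q" using Suc.hyps by simp
    have eq: "M *v poly_act M v q = \<alpha> *s poly_act M v q"
      using Suc.prems(2) unfolding q poly_act_linear_factor by simp
    show ?case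
    proof (cases "poly_act M v q = 0")
      case True
      then show ?thesis using Suc.hyps(1)[OF d \<open>q \<noteq> 0\<close>] by blast
    qed (use eq in blast)
  qed
  moreover obtain p where "p \<noteq> 0" "poly_act M v p = 0"
    by (rule annihilating_poly_exists)
  ultimately obtain q \<alpha> where "poly_act M v q \<noteq> 0" "M *v poly_act M v q = \<alpha> *s poly_act M v q"
    by blast
  then show ?thesis
    using that[of "poly_act M v q" \<alpha>] poly_act_in_invariant_subspace[OF S v(1)] by blast
qed

section \<open>Real matrices acting on complex vectors\<close>

abbreviation complexify :: "real^'n^'n \<Rightarrow> complex^'n^'n" where
  "complexify \<equiv> map_matrix complex_of_real"

lemma complexify_nth [simp]: "complexify A $ i $ j = of_real (A $ i $ j)"
  by (simp add: map_matrix_def)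

lemma complexify_mult: "complexify (A ** B) = complexify A ** complexify B"
  by (simp add: vec_eq_iff matrix_matrix_mult_def)

lemma complexify_diff: "complexify (A - B) = complexify A - complexify B"
  by (simp add: vec_eq_iff)

lemma complexify_add: "complexify (A + B) = complexify A + complexify B"
  by (simp add: vec_eq_iff)

lemma complexify_mat_1: "complexify (mat 1) = mat 1"
  by (simp add: vec_eq_iff mat_def)

lemma complexify_scaleR: "complexify (c *\<^sub>R A) *v u = of_real c *s (complexify A *v u)"
  by (simp add: vec_eq_iff matrix_vector_mult_def sum_distrib_left mult.assoc)

lemma of_real_vector_scalar: "of_real r *s x = r *\<^sub>R x" for x :: "complex^'n"
  by (simp add: vec_eq_iff) (simp add: scaleR_conv_of_real)

lemma bounded_linear_complexify_apply:
  fixes u :: "complex^'n"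
  shows "bounded_linear (\<lambda>A. complexify A *v u)"
  unfolding linear_conv_bounded_linear[symmetric]
  by (rule linearI)
    (simp_all add: complexify_add matrix_vector_mult_add_rdistrib complexify_scaleR of_real_vector_scalar)

lemma complexify_power_eigen:
  assumes "complexify A *v u = z *s u"
  shows "complexify (mat_power A k) *v u = z ^ k *s u"
proof (induction k)
  case (Suc k)
  have "complexify (mat_power A (Suc k)) *v u = complexify A *v (complexify (mat_power A k) *v u)"
    by (simp add: complexify_mult matrix_vector_mul_assoc)
  also have "\<dots> = z ^ Suc k *s u"
    by (simp add: Suc vector_scalar_commute assms vector_smult_assoc mult.commute)
  finally show ?case .
qed (simp add: complexify_mat_1)

lemma vector_scalar_sums:
  fixes u :: "complex^'n"
  assumes "f sums z"
  shows "(\<lambda>k. f k *s u) sums (z *s u)"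
proof -
  have "bounded_linear (\<lambda>z. z *s u)"
    unfolding linear_conv_bounded_linear[symmetric]
    by (rule linearI) (simp_all add: vec_eq_iff algebra_simps)
  from bounded_linear.sums[OF this assms] show ?thesis .
qed

lemma mat_series_eigen:
  assumes "\<exists>\<rho>>mat_norm A. summable (\<lambda>k. \<bar>c k\<bar> * \<rho> ^ k)" "complexify A *v u = z *s u"
    and "(\<lambda>k. of_real (c k) * z ^ k) sums s"
  shows "complexify (mat_series c A) *v u = s *s u"
proof -
  from bounded_linear.sums[OF bounded_linear_complexify_apply mat_series_sums[OF assms(1)], of u]
  have "(\<lambda>k. (of_real (c k) * z ^ k) *s u) sums (complexify (mat_series c A) *v u)"
    by (simp add: complexify_scaleR complexify_power_eigen[OF assms(2)] vector_smult_assoc)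
  with vector_scalar_sums[OF assms(3), of u] show ?thesis
    by (simp add: sums_iff)
qed

lemma mat_exp_eigen:
  assumes "complexify A *v u = z *s u"
  shows "complexify (mat_exp A) *v u = exp z *s u"
  unfolding mat_exp_series
proof (rule mat_series_eigen[OF exp_radius assms])
  show "(\<lambda>k. of_real (exp_coeff k) * z ^ k) sums exp z"
    using exp_converges[of z] by (simp add: exp_coeff_def scaleR_conv_of_real divide_inverse)
qed

text \<open>A real matrix acts separately on real and imaginary parts.\<close>
lemma norm_complexify_apply_le:
  fixes A :: "real^'n^'n" and u :: "complex^'n"
  shows "norm (complexify A *v u) \<le> mat_norm A * norm u"
proof -
  define a b where "a = (\<chi> i. Re (u $ i))" and "b = (\<chi> i. Im (u $ i))"
  have sq: "(norm w)\<^sup>2 = (norm (\<chi> i. Re (w $ i)))\<^sup>2 + (norm (\<chi> i. Im (w $ i)))\<^sup>2" for w :: "complex^'n"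
    by (simp add: norm_vec_def L2_set_def sum_nonneg cmod_power2 sum.distrib)
  have "(\<chi> i. Re ((complexify A *v u) $ i)) = A *v a" "(\<chi> i. Im ((complexify A *v u) $ i)) = A *v b"
    by (simp_all add: vec_eq_iff matrix_vector_mult_def a_def b_def)
  then have "(norm (complexify A *v u))\<^sup>2 = (norm (A *v a))\<^sup>2 + (norm (A *v b))\<^sup>2"
    using sq[of "complexify A *v u"] by simp
  also have "\<dots> \<le> (mat_norm A * norm a)\<^sup>2 + (mat_norm A * norm b)\<^sup>2"
    by (intro add_mono power_mono norm_matrix_vector_le) simp_all
  also have "\<dots> = (mat_norm A * norm u)\<^sup>2"
    using sq[of u] by (simp add: a_def b_def power_mult_distrib algebra_simps)
  finally show ?thesis
    by (rule power2_le_imp_le) (simp add: mat_norm_nonneg)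
qed

lemma eigenvalue_le_mat_norm:
  assumes "complexify A *v u = z *s u" "u \<noteq> 0"
  shows "cmod z \<le> mat_norm A"
proof -
  have "norm (z *s u) = cmod z * norm u"
    by (simp add: norm_vec_def L2_set_def norm_mult power_mult_distrib real_sqrt_mult flip: sum_distrib_left)
  with norm_complexify_apply_le[of A u] assms show ?thesis by simp
qed

lemma subspace_eigenspace: "vec.subspace {u. M *v u = z *s u}" for M :: "complex^'n^'n"
  by (rule vec.subspaceI)
    (auto simp: matrix_vector_right_distrib vec.scale_right_distrib vector_scalar_commute
      vector_smult_assoc mult.commute)

lemma commuting_eigenspace_invariant:
  assumes "A ** N = N ** A" "complexify N *v u = z *s u"
  shows "complexify N *v (complexify A *v u) = z *s (complexify A *v u)"
  using assms by (metis complexify_mult matrix_vector_mul_assoc vector_scalar_commute)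

section \<open>Uniqueness of the principal logarithm\<close>

definition principal_strip :: "real^'n^'n \<Rightarrow> bool" where
  "principal_strip A \<longleftrightarrow> (\<forall>z. complex_eigenvalue A z \<longrightarrow> - pi < Im z \<and> Im z < pi)"

lemma principal_stripD:
  assumes "principal_strip A" "complexify A *v u = z *s u" "u \<noteq> 0"
  shows "\<bar>Im z\<bar> < pi"
proof -
  have "- pi < Im z \<and> Im z < pi"
    using assms unfolding principal_strip_def complex_eigenvalue_def by blast
  then show ?thesis by auto
qed

text \<open>Only \<open>exp \<mu> = 1 + \<eta>\<close> would follow from the eigenvalue equation for \<open>\<mu>\<close>, leaving the branch open.
An eigenvector common to \<open>Y\<close> and the series shows that \<open>\<mu>\<close> is the value of the scalar series at
\<open>\<eta>\<close>, so it is the principal branch.\<close>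
lemma principal_strip_log1p:
  fixes Y :: "real^'n^'n"
  assumes Y: "mat_norm Y < 1"
  shows "principal_strip (log1p Y)"
  unfolding principal_strip_def complex_eigenvalue_def
proof (intro allI impI, elim exE conjE)
  fix \<mu> and v :: "complex^'n" assume v: "v \<noteq> 0" "complexify (log1p Y) *v v = \<mu> *s v"
  note rad = log_radius[OF mat_norm_nonneg Y]
  have comm: "Y ** log1p Y = log1p Y ** Y" by (rule mat_series_commute[OF rad]) simp
  obtain u \<eta> where "u \<in> {u. complexify (log1p Y) *v u = \<mu> *s u}" and u: "u \<noteq> 0" "complexify Y *v u = \<eta> *s u"
    by (rule eigenvector_in_invariant_subspace[OF subspace_eigenspace, of "complexify (log1p Y)" \<mu> "complexify Y" v])
      (use v commuting_eigenspace_invariant[OF comm] in auto)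
  then have u\<mu>: "complexify (log1p Y) *v u = \<mu> *s u" by simp
  have \<eta>: "cmod \<eta> < 1" using eigenvalue_le_mat_norm[OF u(2,1)] Y by simp
  have "complexify (log1p Y) *v u = Ln (1 + \<eta>) *s u"
    by (rule mat_series_eigen[OF rad u(2)]) (use Ln_series[OF \<eta>] in \<open>simp add: log_coeff_def\<close>)
  with u\<mu> u(1) have \<mu>: "\<mu> = Ln (1 + \<eta>)" by (metis vec.scale_right_imp_eq)
  have "0 < Re (1 + \<eta>)" using \<eta> abs_Re_le_cmod[of \<eta>] by simp
  from Re_Ln_pos_lt_imp[OF this] show "- pi < Im \<mu> \<and> Im \<mu> < pi"
    using pi_gt_zero unfolding \<mu> abs_less_iff by linarith
qed

lemma exp_inj_principal_strip:
  assumes "exp z = exp w" "\<bar>Im z\<bar> < pi" "\<bar>Im w\<bar> < pi"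
  shows "z = w"
proof -
  have "Ln (exp z) = z" "Ln (exp w) = w" using assms(2,3) by (auto intro!: Ln_exp simp: abs_less_iff)
  with assms(1) show ?thesis by metis
qed

text \<open>Suppose \<open>N = A - L\<close> is nonzero. By commutativity \<open>A\<close> and \<open>N\<close> share an eigenvector \<open>u = N y\<close> in the range
of \<open>N\<close>, which is then an eigenvector of \<open>L\<close> too. The eigenvalues of \<open>A\<close> and \<open>L\<close> at \<open>u\<close> have the same
exponential, hence are equal to one \<open>\<alpha>\<close> in the strip, so \<open>N u = 0\<close>. As for a Jordan block,
\<open>A\<^sup>k y - L\<^sup>k y = k \<alpha>\<^bsup>k-1\<^esup> u\<close>, and summing over the exponential series gives
\<open>0 = (exp A - exp L) y = exp \<alpha> u\<close>, which is absurd.\<close>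
theorem commuting_principal_logs_eq:
  fixes A L :: "real^'n^'n"
  assumes comm: "A ** L = L ** A" and e: "mat_exp A = mat_exp L"
    and A: "principal_strip A" and L: "principal_strip L"
  shows "A = L"
proof (rule ccontr)
  assume "A \<noteq> L"
  define N where "N = A - L"
  have cN: "complexify N = complexify A - complexify L" by (simp add: N_def complexify_diff)
  have AN: "A ** N = N ** A" by (simp add: N_def matmul.diff_left matmul.diff_right comm)
  obtain i j where ij: "N $ i $ j \<noteq> 0" using \<open>A \<noteq> L\<close> by (auto simp: N_def vec_eq_iff)
  define S where "S = range ((*v) (complexify N))"
  have S: "vec.subspace S"
    unfolding S_def by (rule vec.subspace_image) simp
  have "(complexify N *v axis j 1) $ i = of_real (N $ i $ j)"
    by (simp add: matrix_vector_mult_def axis_def if_distrib[of "\<lambda>x. _ * x"] cong: if_cong)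
  then have "complexify N *v axis j 1 \<in> S" "complexify N *v axis j 1 \<noteq> 0"
    using ij by (auto simp: S_def)
  then obtain u0 \<nu> where u0: "u0 \<in> S" "u0 \<noteq> 0" "complexify N *v u0 = \<nu> *s u0"
    using eigenvector_in_invariant_subspace[OF S, of "complexify N"] by (metis S_def rangeI)
  have "vec.subspace (S \<inter> {u. complexify N *v u = \<nu> *s u})"
    by (rule vec.subspace_inter[OF S subspace_eigenspace])
  moreover have "complexify A *v u \<in> S \<inter> {u. complexify N *v u = \<nu> *s u}"
    if "u \<in> S \<inter> {u. complexify N *v u = \<nu> *s u}" for u
  proof -
    from that obtain y where "u = complexify N *v y" by (auto simp: S_def)
    then have "complexify A *v u = complexify N *v (complexify A *v y)"
      by (simp add: matrix_vector_mul_assoc AN flip: complexify_mult)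
    then have "complexify A *v u \<in> S" by (simp add: S_def)
    moreover have "complexify N *v (complexify A *v u) = \<nu> *s (complexify A *v u)"
      using that by (intro commuting_eigenspace_invariant[OF AN]) simp
    ultimately show ?thesis by simp
  qed
  ultimately obtain u \<alpha> where u: "u \<in> S \<inter> {u. complexify N *v u = \<nu> *s u}" "u \<noteq> 0"
    and Au: "complexify A *v u = \<alpha> *s u"
    using eigenvector_in_invariant_subspace[of _ "complexify A" u0] u0 by blast
  then obtain y where y: "complexify N *v y = u" by (auto simp: S_def)
  have Lu: "complexify L *v u = (\<alpha> - \<nu>) *s u"
  proof -
    have "complexify L *v u = complexify A *v u - complexify N *v u"
      by (simp add: cN matrix_vector_mult_diff_rdistrib)
    then show ?thesis using u Au by (simp add: vec.scale_left_diff_distrib)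
  qed
  have "exp \<alpha> *s u = exp (\<alpha> - \<nu>) *s u"
    using mat_exp_eigen[OF Au] mat_exp_eigen[OF Lu] e by metis
  then have "exp \<alpha> = exp (\<alpha> - \<nu>)" using u(2) by (metis vec.scale_right_imp_eq)
  then have "\<alpha> = \<alpha> - \<nu>"
    by (rule exp_inj_principal_strip[OF _ principal_stripD[OF A Au u(2)] principal_stripD[OF L Lu u(2)]])
  then have Lu: "complexify L *v u = \<alpha> *s u" using Lu by simp
  have diff: "complexify (mat_power A (Suc k) - mat_power L (Suc k)) *v y = (of_nat (Suc k) * \<alpha> ^ k) *s u" for k
  proof (induction k)
    case 0
    show ?case using y by (simp add: N_def)
  next
    case (Suc k)
    have "N ** mat_power L (Suc k) = mat_power L (Suc k) ** N"
      by (rule mat_power_commute) (simp add: N_def matmul.diff_left matmul.diff_right comm)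
    moreover have "mat_power A (Suc (Suc k)) - mat_power L (Suc (Suc k))
      = A ** (mat_power A (Suc k) - mat_power L (Suc k)) + N ** mat_power L (Suc k)"
      by (simp only: mat_power.simps(2)[of _ "Suc k"] N_def matmul.diff_right matmul.diff_left)
        (simp only: diff_add_eq add_diff_eq add_diff_cancel_right')
    ultimately have "mat_power A (Suc (Suc k)) - mat_power L (Suc (Suc k))
      = A ** (mat_power A (Suc k) - mat_power L (Suc k)) + mat_power L (Suc k) ** N"
      by (simp only:)
    then have "complexify (mat_power A (Suc (Suc k)) - mat_power L (Suc (Suc k))) *v y
      = complexify A *v (complexify (mat_power A (Suc k) - mat_power L (Suc k)) *v y)
        + complexify (mat_power L (Suc k)) *v u"
      by (simp only: complexify_add complexify_mult matrix_vector_mult_add_rdistrib y flip: matrix_vector_mul_assoc)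
    also have "\<dots> = (of_nat (Suc k) * \<alpha> ^ k) *s (\<alpha> *s u) + \<alpha> ^ Suc k *s u"
      by (simp only: Suc vector_scalar_commute Au complexify_power_eigen[OF Lu])
    also have "\<dots> = (of_nat (Suc (Suc k)) * \<alpha> ^ Suc k) *s u"
      by (simp add: vec_eq_iff algebra_simps)
    finally show ?case .
  qed
  have "(\<lambda>k. exp_coeff k *\<^sub>R mat_power A k - exp_coeff k *\<^sub>R mat_power L k) sums (mat_exp A - mat_exp L)"
    unfolding mat_exp_series by (intro sums_diff mat_series_sums exp_radius)
  then have "(\<lambda>k. exp_coeff k *\<^sub>R (mat_power A k - mat_power L k)) sums 0"
    by (simp add: e scaleR_diff_right)
  then have "(\<lambda>k. exp_coeff (Suc k) *\<^sub>R (mat_power A (Suc k) - mat_power L (Suc k))) sums 0"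
    by (subst sums_Suc_iff) simp
  from bounded_linear.sums[OF bounded_linear_complexify_apply this, of y]
  have "(\<lambda>k. of_real (exp_coeff (Suc k)) *s ((of_nat (Suc k) * \<alpha> ^ k) *s u)) sums 0"
    unfolding complexify_scaleR diff by (simp add: complexify_diff[of 0 0, simplified])
  moreover have "of_real (exp_coeff (Suc k)) * (of_nat (Suc k) * \<alpha> ^ k) = \<alpha> ^ k /\<^sub>R fact k" for k
    by (simp add: exp_coeff_def scaleR_conv_of_real divide_simps del: of_nat_Suc)
  ultimately have "(\<lambda>k. (\<alpha> ^ k /\<^sub>R fact k) *s u) sums 0"
    by (simp only: vector_smult_assoc)
  with vector_scalar_sums[OF exp_converges[of \<alpha>], of u] have "exp \<alpha> *s u = 0"
    by (metis sums_unique2)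
  with u(2) show False by simp
qed

section \<open>The principal logarithm on the unit ball around the identity\<close>

text \<open>Any logarithm \<open>A\<close> of \<open>X\<close> commutes with \<open>X = exp A\<close>, hence with the logarithm series of \<open>X\<close>. So the
uniqueness theorem for commuting logarithms is enough.\<close>
lemma mat_log_eqI:
  assumes X: "mat_norm (X - mat 1) < 1" and A: "mat_exp A = X" "principal_strip A"
  shows "A = log1p (X - mat 1)"
proof -
  note rad = log_radius[OF mat_norm_nonneg X]
  have "A ** X = X ** A"
    using mat_series_commute[OF exp_radius refl, of A] by (simp add: A(1)[symmetric] mat_exp_series)
  then have "A ** (X - mat 1) = (X - mat 1) ** A"
    by (simp add: matmul.diff_left matmul.diff_right)
  then have "A ** log1p (X - mat 1) = log1p (X - mat 1) ** A"
    by (rule mat_series_commute[OF rad])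
  then show ?thesis
    by (rule commuting_principal_logs_eq[OF _ _ A(2) principal_strip_log1p[OF X]])
      (simp add: mat_exp_log1p[OF X] A(1))
qed

lemma mat_log_eq_log1p:
  assumes X: "mat_norm (X - mat 1) < 1"
  shows "mat_log X = log1p (X - mat 1)"
  unfolding mat_log_def principal_strip_def[symmetric]
proof (rule the_equality)
  show "mat_exp (log1p (X - mat 1)) = X \<and> principal_strip (log1p (X - mat 1))"
    using mat_exp_log1p[OF X] principal_strip_log1p[OF X] by simp
qed (use mat_log_eqI[OF X] in blast)

lemma mat_exp_mat_log:
  assumes "mat_norm (X - mat 1) < 1"
  shows "mat_exp (mat_log X) = X"
  using mat_exp_log1p[OF assms] by (simp add: mat_log_eq_log1p[OF assms])

lemma mat_ball_subset_domain: "mat_ball (mat 1) 1 \<subseteq> (GL \<inter> mat_log_domain :: (real^'n^'n) set)"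
proof
  fix X :: "real^'n^'n" assume "X \<in> mat_ball (mat 1) 1"
  then have X: "mat_norm (X - mat 1) < 1" by (simp add: in_mat_ball)
  have "mat_series inv_coeff (X - mat 1) ** X = mat 1"
    using inv_series_inverse[OF X] by simp
  then have "X \<in> GL"
    unfolding GL_def by (simp add: invertible_left_inverse) blast
  moreover have "z \<notin> \<real>\<^sub>\<le>\<^sub>0" if z: "complex_eigenvalue X z" for z
  proof -
    obtain v :: "complex^'n" where v: "v \<noteq> 0" "complexify X *v v = z *s v"
      using z unfolding complex_eigenvalue_def by blast
    then have "complexify (X - mat 1) *v v = (z - 1) *s v"
      by (simp add: complexify_diff complexify_mat_1 matrix_vector_mult_diff_rdistrib vec.scale_left_diff_distrib)
    from eigenvalue_le_mat_norm[OF this v(1)] X have "cmod (z - 1) < 1" by simp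
    then have "0 < Re z" using abs_Re_le_cmod[of "z - 1"] by simp
    then show ?thesis by (auto simp: complex_nonpos_Reals_iff)
  qed
  ultimately show "X \<in> GL \<inter> mat_log_domain" by (simp add: mat_log_domain_def)
qed

lemma Ck_on_subset: "Ck_on k T f \<Longrightarrow> S \<subseteq> T \<Longrightarrow> Ck_on k S f"
  by (induction k arbitrary: f) (auto intro: continuous_on_subset)

lemma mat_log_has_derivative:
  fixes E :: "real^'n^'n"
  assumes E: "E \<in> mat_ball (mat 1) 1"
  obtains D where "(mat_log has_derivative D) (at E)"
    "\<And>V. E ** V = V ** E \<Longrightarrow> E ** D V = V"
proof -
  have E1: "mat_norm (E - mat 1) < 1" using E by (simp add: in_mat_ball)
  obtain D where D: "(log1p has_derivative D) (at (E - mat 1))"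
    "\<And>V. (E - mat 1) ** V = V ** (E - mat 1) \<Longrightarrow> D V = mat_series (diffs log_coeff) (E - mat 1) ** V"
    using mat_series_has_derivative[OF log_radius[OF mat_norm_nonneg E1]] by blast
  have "((\<lambda>X. X - mat 1) has_derivative (\<lambda>V. V)) (at E)"
    by (auto intro!: derivative_eq_intros)
  from has_derivative_compose[OF this D(1)]
  have "((\<lambda>X. log1p (X - mat 1)) has_derivative D) (at E)" .
  then have 1: "(mat_log has_derivative D) (at E)"
    by (rule has_derivative_transform_within_open[OF _ open_mat_ball E])
      (simp add: mat_log_eq_log1p in_mat_ball)
  have "mat_series inv_coeff (E - mat 1) ** E = mat 1" using inv_series_inverse[OF E1] by simp
  then have inv: "E ** mat_series inv_coeff (E - mat 1) = mat 1"
    using matrix_left_right_inverse by blast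
  have "E ** D V = V" if "E ** V = V ** E" for V
  proof -
    have "(E - mat 1) ** V = V ** (E - mat 1)"
      using that by (simp add: matmul.diff_left matmul.diff_right)
    then have "E ** D V = (E ** mat_series inv_coeff (E - mat 1)) ** V"
      by (simp add: D(2) diffs_log_coeff matrix_mul_assoc)
    then show ?thesis by (simp add: inv)
  qed
  with 1 show ?thesis by (rule that)
qed

text \<open>\<open>E log E\<close> commutes with \<open>E\<close>, so the derivative of the logarithm maps it to \<open>E\<^sup>-\<^sup>1 E log E = log E\<close>. This
is the equivalence of the two vector fields.\<close>
lemma mat_log_derivative_radial:
  fixes E :: "real^'n^'n"
  assumes E: "E \<in> mat_ball (mat 1) 1"
  shows "(mat_log has_derivative frechet_derivative mat_log (at E)) (at E)"
    "frechet_derivative mat_log (at E) (c *\<^sub>R (E ** mat_log E)) = c *\<^sub>R mat_log E"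
proof -
  have E1: "mat_norm (E - mat 1) < 1" using E by (simp add: in_mat_ball)
  obtain D where D: "(mat_log has_derivative D) (at E)" "\<And>V. E ** V = V ** E \<Longrightarrow> E ** D V = V"
    using mat_log_has_derivative[OF E] by blast
  have fD: "frechet_derivative mat_log (at E) = D"
    using frechet_derivative_at[OF D(1)] by simp
  show "(mat_log has_derivative frechet_derivative mat_log (at E)) (at E)"
    using D(1) by (simp add: fD)
  have inv: "mat_series inv_coeff (E - mat 1) ** E = mat 1" using inv_series_inverse[OF E1] by simp
  have "E ** (E - mat 1) = (E - mat 1) ** E" by (simp add: matmul.diff_left matmul.diff_right)
  then have "E ** mat_log E = mat_log E ** E"
    unfolding mat_log_eq_log1p[OF E1] by (rule mat_series_commute[OF log_radius[OF mat_norm_nonneg E1]])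
  then have "E ** (c *\<^sub>R (E ** mat_log E)) = (c *\<^sub>R (E ** mat_log E)) ** E"
    by (simp add: matmul.scaleR_left matmul.scaleR_right) (metis matrix_mul_assoc)
  then have "E ** D (c *\<^sub>R (E ** mat_log E)) = E ** (c *\<^sub>R mat_log E)"
    by (simp add: D(2) matmul.scaleR_right)
  then show "frechet_derivative mat_log (at E) (c *\<^sub>R (E ** mat_log E)) = c *\<^sub>R mat_log E"
    unfolding fD by (metis inv matrix_mul_assoc matrix_mul_lid)
qed

text \<open>The inverse is a restriction of the everywhere smooth \<open>exp\<close>, and the image is open by invariance of
domain.\<close>
lemma mat_log_diffeomorphism:
  "diffeomorphism_onto_image (mat_ball (mat 1 :: real^'n^'n) 1) mat_log"
proof -
  define U where "U = mat_ball (mat 1 :: real^'n^'n) 1"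
  have oU: "open U" by (simp add: U_def open_mat_ball)
  have U: "mat_norm (X - mat 1) < 1" if "X \<in> U" for X
    using that by (simp add: U_def in_mat_ball)
  have log: "Ck_on k U mat_log" for k
    by (rule Ck_on_cong[OF oU _ mat_series_Ck_on[OF oU log_radius[OF mat_norm_nonneg U]]])
      (simp add: mat_log_eq_log1p U)
  have inj: "inj_on mat_log U"
    by (rule inj_on_inverseI[of _ mat_exp]) (simp add: mat_exp_mat_log U)
  have cont: "continuous_on U mat_log" using log[of 0] by simp
  have oV: "open (mat_log ` U)"
    by (rule invariance_of_domain[OF cont oU inj])
  have "Ck_on k (mat_log ` U) mat_exp" for k
    using mat_series_Ck_on[where C = 0 and k = k, OF open_UNIV exp_radius] Ck_on_subset[of k UNIV]
    by (simp add: mat_exp_series)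
  then have "Ck_on k (mat_log ` U) (inv_into U mat_log)" for k
    by (rule Ck_on_cong[OF oV, rotated]) (auto simp: inv_into_f_f[OF inj] mat_exp_mat_log U)
  with oU oV inj log show ?thesis
    by (simp add: diffeomorphism_onto_image_def smooth_on_def U_def)
qed

lemma principal_strip_scaleR:
  fixes A :: "real^'n^'n"
  assumes "principal_strip A" "0 \<le> s" "s \<le> 1"
  shows "principal_strip (s *\<^sub>R A)"
  unfolding principal_strip_def complex_eigenvalue_def
proof (intro allI impI, elim exE conjE)
  fix z and v :: "complex^'n" assume v: "v \<noteq> 0" "complexify (s *\<^sub>R A) *v v = z *s v"
  show "- pi < Im z \<and> Im z < pi"
  proof (cases "s = 0")
    case True
    then have "z *s v = 0" using v(2) unfolding complexify_scaleR by simp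
    then show ?thesis using v pi_gt_zero by simp
  next
    case False
    have "complexify A *v v = (inverse (of_real s) * of_real s) *s (complexify A *v v)"
      using False by simp
    also have "\<dots> = (inverse (of_real s) * z) *s v"
      using v by (simp only: complexify_scaleR flip: vector_smult_assoc)
    finally have "\<bar>Im (inverse (of_real s) * z)\<bar> < pi"
      using principal_stripD[OF assms(1) _ v(1)] by blast
    moreover have "Im (inverse (of_real s) * z) = inverse s * Im z"
      using False by (simp add: power2_eq_square field_simps)
    ultimately have "inverse s * \<bar>Im z\<bar> < pi"
      using assms(2) by (simp add: abs_mult)
    then have "\<bar>Im z\<bar> < s * pi" using False assms(2) by (simp add: field_simps)
    also have "\<dots> \<le> 1 * pi" using assms by (intro mult_right_mono) simp_all
    finally show ?thesis by (simp add: abs_less_iff)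
  qed
qed

section \<open>Exponential stability\<close>

lemma mat_norm_mat_log_le:
  fixes X :: "real^'n^'n"
  assumes X: "mat_norm (X - mat 1) \<le> 1 / 2"
  shows "mat_norm (mat_log X) \<le> 2 * mat_norm (X - mat 1)"
proof -
  define r where "r = mat_norm (X - mat 1)"
  have r: "0 \<le> r" "r \<le> 1 / 2" "r < 1" using X mat_norm_nonneg[of "X - mat 1"] by (simp_all add: r_def)
  have s: "(\<lambda>k. log_coeff k *\<^sub>R mat_power (X - mat 1) k) sums mat_log X"
    using mat_series_sums[OF log_radius[OF mat_norm_nonneg r(3)[unfolded r_def]]]
    by (simp only: mat_log_eq_log1p[OF r(3)[unfolded r_def]])
  have "(\<lambda>k. log_coeff (Suc k) *\<^sub>R mat_power (X - mat 1) (Suc k)) sums mat_log X"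
    using s by (subst sums_Suc_iff) (simp add: log_coeff_def)
  moreover have "(\<lambda>k. r * r ^ k) sums (r * (1 / (1 - r)))"
    using r by (intro sums_mult geometric_sums) simp
  ultimately have "mat_norm (mat_log X) \<le> r * (1 / (1 - r))"
  proof (rule mat_norm_sums_le)
    fix k
    have "mat_norm (log_coeff (Suc k) *\<^sub>R mat_power (X - mat 1) (Suc k)) \<le> 1 * r ^ Suc k"
      unfolding mat_norm_scaleR
      by (intro mult_mono mat_norm_power_le[of "X - mat 1" "Suc k", folded r_def])
        (auto simp: log_coeff_def power_abs mat_norm_nonneg simp del: mat_power.simps)
    then show "mat_norm (log_coeff (Suc k) *\<^sub>R mat_power (X - mat 1) (Suc k)) \<le> r * r ^ k" by simp
  qed
  also have "\<dots> \<le> r * 2" using r by (intro mult_left_mono) (simp_all add: divide_simps)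
  finally show ?thesis by (simp add: r_def)
qed

lemma mat_norm_mat_exp_minus_1_le:
  fixes A :: "real^'n^'n"
  assumes A: "mat_norm A \<le> 1"
  shows "mat_norm (mat_exp A - mat 1) \<le> 2 * mat_norm A"
proof -
  define r where "r = mat_norm A"
  have r: "0 \<le> r" "r \<le> 1" using A by (simp_all add: r_def mat_norm_nonneg)
  have s: "(\<lambda>k. exp_coeff k *\<^sub>R mat_power A k) sums mat_exp A"
    unfolding mat_exp_series by (rule mat_series_sums[OF exp_radius])
  have "(\<lambda>k. exp_coeff (Suc k) *\<^sub>R mat_power A (Suc k)) sums (mat_exp A - mat 1)"
    using s by (subst sums_Suc_iff) (simp add: exp_coeff_def)
  moreover have "(\<lambda>k. exp_coeff (Suc k) * r ^ Suc k) sums (exp r - 1)"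
    using exp_converges[of r]
    by (subst sums_Suc_iff) (simp add: exp_coeff_def divide_inverse)
  ultimately have "mat_norm (mat_exp A - mat 1) \<le> exp r - 1"
  proof (rule mat_norm_sums_le)
    fix k
    show "mat_norm (exp_coeff (Suc k) *\<^sub>R mat_power A (Suc k)) \<le> exp_coeff (Suc k) * r ^ Suc k"
      unfolding mat_norm_scaleR r_def
      by (intro mult_mono mat_norm_power_le) (auto simp: exp_coeff_def mat_norm_nonneg simp del: mat_power.simps)
  qed
  also have "exp r - 1 \<le> r + r\<^sup>2" using exp_bound[OF r] by simp
  also have "r\<^sup>2 \<le> r" using r by (simp add: power2_eq_square mult_left_le_one_le)
  finally show ?thesis by (simp add: r_def)
qed


text \<open>In logarithmic coordinates the flow shrinks \<open>log X\<close> by a factor \<open>s = exp (- a t)\<close>. The radius \<open>1 / 8\<close>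
keeps \<open>exp (s log X)\<close> within distance \<open>1 / 2\<close> of the identity.\<close>
lemma mat_exp_scaled_log:
  fixes X :: "real^'n^'n"
  assumes X: "mat_norm (X - mat 1) < 1 / 8" and s: "0 \<le> s" "s \<le> 1"
  shows "mat_norm (mat_exp (s *\<^sub>R mat_log X) - mat 1) \<le> 4 * s * mat_norm (X - mat 1)"
    and "mat_log (mat_exp (s *\<^sub>R mat_log X)) = s *\<^sub>R mat_log X"
proof -
  let ?A = "s *\<^sub>R mat_log X" and ?r = "mat_norm (X - mat 1)"
  have r: "0 \<le> ?r" by (rule mat_norm_nonneg)
  have "mat_norm ?A \<le> s * (2 * ?r)"
    using mat_norm_mat_log_le[of X] X s by (simp add: mat_norm_scaleR mult_left_mono)
  moreover have "s * ?r \<le> 1 * ?r" using s r by (intro mult_right_mono)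
  moreover from calculation have "mat_norm ?A \<le> 1" using X by simp
  from mat_norm_mat_exp_minus_1_le[OF this]
  have "mat_norm (mat_exp ?A - mat 1) \<le> 2 * mat_norm ?A" .
  ultimately show 1: "mat_norm (mat_exp ?A - mat 1) \<le> 4 * s * ?r" by simp
  with \<open>s * ?r \<le> 1 * ?r\<close> X have small: "mat_norm (mat_exp ?A - mat 1) < 1" by simp
  have "principal_strip (mat_log X)"
    using principal_strip_log1p[of "X - mat 1"] mat_log_eq_log1p[of X] X by simp
  from mat_log_eqI[OF small refl principal_strip_scaleR[OF this s]]
  show "mat_log (mat_exp ?A) = ?A" by (simp add: mat_log_eq_log1p[OF small])
qed

context
  fixes a :: real and F :: "real^'n^'n \<Rightarrow> real^'n^'n"
  assumes a: "a > 0" and F: "F = (\<lambda>E. - a *\<^sub>R (E ** mat_log E))"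
begin

lemma log_flow_exists:
  assumes X0: "mat_norm (X0 - mat 1) < 1 / 8"
  shows "ode_solution F (GL \<inter> mat_log_domain) {0..} (\<lambda>t. mat_exp (exp (- a * t) *\<^sub>R mat_log X0))"
  unfolding ode_solution_def
proof (intro ballI conjI)
  fix t :: real assume "t \<in> {0..}"
  define s where "s = exp (- a * t)"
  have s: "0 \<le> s" "s \<le> 1" using a \<open>t \<in> {0..}\<close> by (simp_all add: s_def)
  note sl = mat_exp_scaled_log[OF X0 s]
  have "s * mat_norm (X0 - mat 1) \<le> 1 * mat_norm (X0 - mat 1)"
    using s by (intro mult_right_mono) (simp_all add: mat_norm_nonneg)
  then have "mat_norm (mat_exp (s *\<^sub>R mat_log X0) - mat 1) < 1" using sl(1) X0 by linarith
  then show "mat_exp (exp (- a * t) *\<^sub>R mat_log X0) \<in> GL \<inter> mat_log_domain"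
    using mat_ball_subset_domain in_mat_ball unfolding s_def by blast
  have "((\<lambda>t. exp (- a * t) *\<^sub>R mat_log X0) has_vector_derivative (- a * s) *\<^sub>R mat_log X0) (at t within {0..})"
    unfolding s_def by (auto intro!: derivative_eq_intros)
  moreover have "(exp (- a * t) *\<^sub>R mat_log X0) ** ((- a * s) *\<^sub>R mat_log X0)
      = ((- a * s) *\<^sub>R mat_log X0) ** (exp (- a * t) *\<^sub>R mat_log X0)"
    by (simp only: matmul.scaleR_left matmul.scaleR_right scaleR_left_commute)
  ultimately have "((\<lambda>t. mat_exp (exp (- a * t) *\<^sub>R mat_log X0)) has_vector_derivative
      mat_exp (s *\<^sub>R mat_log X0) ** ((- a * s) *\<^sub>R mat_log X0)) (at t within {0..})"
    using mat_series_vector_derivative[OF exp_radius, of "\<lambda>t. exp (- a * t) *\<^sub>R mat_log X0"]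
    unfolding mat_exp_series diffs_exp_coeff s_def by blast
  moreover have "mat_exp (s *\<^sub>R mat_log X0) ** ((- a * s) *\<^sub>R mat_log X0) = F (mat_exp (s *\<^sub>R mat_log X0))"
    by (simp only: F sl(2) matmul.scaleR_right scaleR_scaleR)
  ultimately show "((\<lambda>t. mat_exp (exp (- a * t) *\<^sub>R mat_log X0)) has_vector_derivative
      F (mat_exp (exp (- a * t) *\<^sub>R mat_log X0))) (at t within {0..})"
    by (simp only: s_def)
qed

text \<open>As long as a solution stays in the ball, \<open>exp (a t) log (x t)\<close> has derivative zero.\<close>
lemma log_flow_unique_in_ball:
  assumes ode: "\<And>t. t \<in> {0..\<tau>} \<Longrightarrow> (x has_vector_derivative F (x t)) (at t within {0..\<tau>})"
    and ball: "\<And>t. t \<in> {0..\<tau>} \<Longrightarrow> x t \<in> mat_ball (mat 1) 1" and \<tau>: "0 \<le> \<tau>"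
  shows "x \<tau> = mat_exp (exp (- a * \<tau>) *\<^sub>R mat_log (x 0))"
proof -
  have const: "((\<lambda>t. exp (a * t) *\<^sub>R mat_log (x t)) has_vector_derivative 0) (at t within {0..\<tau>})"
    if t: "t \<in> {0..\<tau>}" for t
  proof -
    note der = mat_log_derivative_radial[OF ball[OF t]]
    have "((\<lambda>t. mat_log (x t)) has_vector_derivative - a *\<^sub>R mat_log (x t)) (at t within {0..\<tau>})"
      using vector_derivative_diff_chain_within[OF ode[OF t] has_derivative_at_withinI[OF der(1)]]
      by (simp only: F der(2) o_def)
    then show ?thesis
      by (auto intro!: derivative_eq_intros)
  qed
  obtain c where c: "\<And>t. t \<in> {0..\<tau>} \<Longrightarrow> exp (a * t) *\<^sub>R mat_log (x t) = c"
    using has_vector_derivative_zero_constant[OF convex_real_interval(5) const] by blast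
  have eq: "exp (a * \<tau>) *\<^sub>R mat_log (x \<tau>) = mat_log (x 0)"
    using c[of 0] c[of \<tau>] \<tau> by simp
  have "exp (- a * \<tau>) *\<^sub>R mat_log (x 0) = mat_log (x \<tau>)"
    unfolding eq[symmetric] by (simp add: exp_minus)
  then show ?thesis
    using mat_exp_mat_log[of "x \<tau>"] ball[of \<tau>] \<tau> by (simp add: in_mat_ball)
qed

text \<open>A solution that starts near the identity cannot leave the unit ball: at the first time \<open>u\<close> with
\<open>\<parallel>x u - 1\<parallel> \<ge> 3 / 4\<close> the explicit formula would still hold and give a norm of at most \<open>1 / 2\<close>.\<close>
lemma log_flow_estimate:
  assumes X0: "mat_norm (x 0 - mat 1) < 1 / 8" and sol: "ode_solution F D {0..<T} x"
    and \<tau>: "\<tau> \<in> {0..<T}"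
  shows "mat_norm (x \<tau> - mat 1) \<le> 4 * exp (- a * \<tau>) * mat_norm (x 0 - mat 1)"
proof -
  define n where "n t = mat_norm (x t - mat 1)" for t
  have estimate: "n t \<le> 4 * exp (- a * t) * n 0"
    if t: "t \<in> {0..<T}" and ball: "\<And>u. u \<in> {0..t} \<Longrightarrow> n u < 1" for t
  proof -
    have "x t = mat_exp (exp (- a * t) *\<^sub>R mat_log (x 0))"
    proof (rule log_flow_unique_in_ball)
      fix u assume u: "u \<in> {0..t}"
      then have "(x has_vector_derivative F (x u)) (at u within {0..<T})"
        using sol t by (simp add: ode_solution_def)
      then show "(x has_vector_derivative F (x u)) (at u within {0..t})"
        by (rule has_vector_derivative_within_subset) (use t in auto)
    qed (use t ball in \<open>auto simp: in_mat_ball n_def\<close>)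
    then show ?thesis
      using mat_exp_scaled_log(1)[OF X0, of "exp (- a * t)"] t a by (simp add: n_def)
  qed
  have "continuous_on {0..<T} x"
    using sol unfolding ode_solution_def continuous_on_eq_continuous_within
    by (blast intro: has_vector_derivative_continuous)
  then have "continuous_on {0..<T} n"
    unfolding n_def by (intro continuous_on_compose2[OF continuous_on_mat_norm[of UNIV]] continuous_intros) auto
  then have cont: "continuous_on {0..t} n" if "t < T" for t
    using that by (auto elim: continuous_on_subset)
  have "n t < 1" if t: "t \<in> {0..<T}" for t
  proof (rule ccontr)
    assume "\<not> n t < 1"
    define S where "S = {0..t} \<inter> n -` {3/4..}"
    have "closed S"
      unfolding S_def using t by (intro continuous_closed_preimage cont) auto
    then have "compact S"
      by (auto simp: compact_eq_bounded_closed S_def intro: bounded_subset[OF bounded_closed_interval])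
    moreover have "t \<in> S" using \<open>\<not> n t < 1\<close> t by (simp add: S_def)
    ultimately obtain u where u: "u \<in> S" "\<And>v. v \<in> S \<Longrightarrow> u \<le> v"
      using compact_attains_inf[of S] by blast
    have "n 0 < 1 / 8" using X0 by (simp add: n_def)
    with u(1) have "u > 0" by (cases "u = 0") (auto simp: S_def)
    have before: "n v \<le> 3 / 4" if "v \<in> {0..<u}" for v
    proof (rule ccontr)
      assume "\<not> n v \<le> 3 / 4"
      then have "v \<in> S" using u(1) that by (auto simp: S_def)
      from u(2)[OF this] that show False by simp
    qed
    have "n v \<le> 3 / 4" if "v \<in> {0..u}" for v
    proof (rule continuous_le_on_closure[where S = "{0..<u}" and f = n])
      show "continuous_on (closure {0..<u}) n"
        using \<open>u > 0\<close> u(1) t by (simp add: closure_atLeastLessThan cont S_def)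
    qed (use before that \<open>u > 0\<close> in \<open>auto simp: closure_atLeastLessThan\<close>)
    then have "n u \<le> 4 * exp (- a * u) * n 0"
      using u(1) t by (intro estimate) (force simp: S_def)+
    also have "\<dots> \<le> 4 * 1 * n 0"
      using a \<open>u > 0\<close> mat_norm_nonneg[of "x 0 - mat 1"] by (intro mult_right_mono mult_left_mono) (auto simp: n_def)
    finally show False using u(1) X0 by (simp add: S_def n_def)
  qed
  then show ?thesis
    using estimate[OF \<tau>] \<tau> by (auto simp: n_def)
qed

lemma log_flow_locally_exponentially_stable:
  "locally_exponentially_stable F (GL \<inter> mat_log_domain) (mat 1)"
proof -
  have "mat_norm (mat 1 - mat 1 :: real^'n^'n) < 1" by simp
  from mat_log_eq_log1p[OF this] have "mat_log (mat 1 :: real^'n^'n) = 0"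
    by (simp add: mat_series_0 log_coeff_def)
  then have "F (mat 1) = 0" by (simp add: F)
  moreover have "(mat 1 :: real^'n^'n) \<in> GL \<inter> mat_log_domain"
    using mat_ball_subset_domain by (rule subsetD) (simp add: in_mat_ball)
  moreover have "\<exists>x. x 0 = X0 \<and> ode_solution F (GL \<inter> mat_log_domain) {0..} x"
    if "mat_norm (X0 - mat 1) < 1 / 8" for X0
    by (rule exI[of _ "\<lambda>t. mat_exp (exp (- a * t) *\<^sub>R mat_log X0)"])
      (use log_flow_exists[OF that] mat_exp_mat_log[of X0] that in simp)
  ultimately show ?thesis
    unfolding locally_exponentially_stable_def
    by (intro conjI exI[of _ "1 / 8"] exI[of _ 4] exI[of _ a]) (use a log_flow_estimate in auto)
qed

end

theorem mainTheorem4: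
  fixes a0 :: real
  assumes "a0 > 0"
  shows "diff_equivalent_via mat_log (mat_ball (mat 1 :: real^'n^'n) 1)
           (\<lambda>E. - a0 *\<^sub>R (E ** mat_log E)) (\<lambda>e. - a0 *\<^sub>R e)
       \<and> locally_exponentially_stable (\<lambda>E. - a0 *\<^sub>R (E ** mat_log E))
           (GL \<inter> mat_log_domain) (mat 1 :: real^'n^'n)"
proof
  show "diff_equivalent_via mat_log (mat_ball (mat 1 :: real^'n^'n) 1)
      (\<lambda>E. - a0 *\<^sub>R (E ** mat_log E)) (\<lambda>e. - a0 *\<^sub>R e)"
    unfolding diff_equivalent_via_def
    by (intro conjI ballI mat_log_diffeomorphism mat_log_derivative_radial(2))
  show "locally_exponentially_stable (\<lambda>E. - a0 *\<^sub>R (E ** mat_log E))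
      (GL \<inter> mat_log_domain) (mat 1 :: real^'n^'n)"
    by (rule log_flow_locally_exponentially_stable[OF assms refl])
qed

end
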